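(* Let $n\ge 4$. The open Parke--Taylor variety $\mathrm{PT}^\circ_n\subset\mathbb{P}^{(n-2)!-1}$ is isomorphic to the moduli space $\mathcal{M}_{0,n}$ of $n$ distinct marked points on $\mathbb{P}^1$ up to projective transformations.
   Context: All varieties are over $\mathbb{C}$. $\mathrm{Gr}(2,n)$ is the Grassmannian of $2$-dimensional subspaces of $\mathbb{C}^n$ with Pl\"ucker coordinates $p_{ij}$ (the $2\times 2$ minors of a $2\times n$ matrix representative, so $p_{ji}=-p_{ij}$). For a permutation $\sigma=\sigma_1\cdots\sigma_n$ of $[n]=\{1,\dots,n\}$ (one-line notation) the Parke--Taylor function is $f_\sigma=\prod_{i=1}^n \frac{1}{p_{\sigma_i\sigma_{i+1}}}$, with $\sigma_{n+1}:=\sigma_1$. Let $\Sigma_n$ be the set of permutations $\sigma$ of $[n]$ with $\sigma_1=1$, $\sigma_2=2$, so $|\Sigma_n|=(n-2)!$, and let $\mathbb{P}^{(n-2)!-1}$ have homogeneous coordinates $z_\sigma$, $\sigma\in\Sigma_n$. The rational map $\varphi_n:\mathrm{Gr}(2,n)\dashrightarrow\mathbb{P}^{(n-2)!-1}$ is $V\mapsto (f_\sigma(V))_{\sigma\in\Sigma_n}$, defined on the locus where all $p_{ij}\neq 0$. The open Parke--Taylor variety $\mathrm{PT}^\circ_n$ is the image of this locus under $\varphi_n$, and the Parke--Taylor variety $\mathrm{PT}_n$ is the Zariski closure of $\mathrm{PT}^\circ_n$ in $\mathbb{P}^{(n-2)!-1}$. *)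

theory Defs
  imports "HOL-Analysis.Analysis" "HOL-Combinatorics.Permutations"
    "HOL-Library.Poly_Mapping" "HOL-Library.Function_Algebras"
begin

section \<open>Spaces with functions and their morphisms\<close>

text \<open>A classical variety over the complex numbers is handled as a topological space together with
  its sheaf of regular complex-valued functions. The predicate \<open>regular X U f\<close> says that the
  restriction of \<open>f\<close> to the open set \<open>U\<close> is a section; the values of \<open>f\<close> outside \<open>U\<close> are
  irrelevant.\<close>

record 'p fspace =
  space_top :: "'p topology"
  regular :: "'p set \<Rightarrow> ('p \<Rightarrow> complex) \<Rightarrow> bool"

abbreviation points :: "'p fspace \<Rightarrow> 'p set" where
  "points X \<equiv> topspace (space_top X)"

definition morphism :: "'p fspace \<Rightarrow> 'q fspace \<Rightarrow> ('p \<Rightarrow> 'q) \<Rightarrow> bool" where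
  "morphism X Y h \<longleftrightarrow> continuous_map (space_top X) (space_top Y) h \<and>
     (\<forall>V g. openin (space_top Y) V \<and> regular Y V g \<longrightarrow> regular X {x \<in> points X. h x \<in> V} (g \<circ> h))"

definition isomorphic_varieties :: "'p fspace \<Rightarrow> 'q fspace \<Rightarrow> bool" where
  "isomorphic_varieties X Y \<longleftrightarrow> (\<exists>h k. morphism X Y h \<and> morphism Y X k \<and>
     (\<forall>x\<in>points X. k (h x) = x) \<and> (\<forall>y\<in>points Y. h (k y) = y))"

text \<open>The quotient of a space with functions by a surjection \<open>q\<close>: quotient topology, and the regular
  functions are those whose pullback along \<open>q\<close> is regular. For the orbit map of a group action the
  latter are the invariant regular functions on the preimage.\<close>

definition quotient_fspace :: "'p fspace \<Rightarrow> ('p \<Rightarrow> 'q) \<Rightarrow> 'q fspace" where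
  "quotient_fspace X q =
     \<lparr>space_top = topology (\<lambda>V. V \<subseteq> q ` points X \<and> openin (space_top X) {x \<in> points X. q x \<in> V}),
      regular = (\<lambda>V f. regular X {x \<in> points X. q x \<in> V} (f \<circ> q))\<rparr>"

lemma openin_quotient_fspace:
  "openin (space_top (quotient_fspace X q)) V \<longleftrightarrow>
     V \<subseteq> q ` points X \<and> openin (space_top X) {x \<in> points X. q x \<in> V}"
proof -
  have "istopology (\<lambda>V. V \<subseteq> q ` points X \<and> openin (space_top X) {x \<in> points X. q x \<in> V})"
    unfolding istopology_def
  proof (intro conjI allI impI)
    fix S T
    assume S: "S \<subseteq> q ` points X \<and> openin (space_top X) {x \<in> points X. q x \<in> S}"
      and T: "T \<subseteq> q ` points X \<and> openin (space_top X) {x \<in> points X. q x \<in> T}"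
    show "S \<inter> T \<subseteq> q ` points X" using S by blast
    have "{x \<in> points X. q x \<in> S \<inter> T} = {x \<in> points X. q x \<in> S} \<inter> {x \<in> points X. q x \<in> T}"
      by auto
    then show "openin (space_top X) {x \<in> points X. q x \<in> S \<inter> T}"
      using S T by (simp only: openin_Int)
  next
    fix K
    assume K: "\<forall>S\<in>K. S \<subseteq> q ` points X \<and> openin (space_top X) {x \<in> points X. q x \<in> S}"
    show "\<Union>K \<subseteq> q ` points X" using K by blast
    have "{x \<in> points X. q x \<in> \<Union>K} = (\<Union>S\<in>K. {x \<in> points X. q x \<in> S})" by auto
    then show "openin (space_top X) {x \<in> points X. q x \<in> \<Union>K}"
      using K by (auto simp only: intro!: openin_Union)
  qed
  then show ?thesis
    unfolding quotient_fspace_def by (simp only: topology_inverse' fspace.simps)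
qed

lemma points_quotient_fspace: "points (quotient_fspace X q) = q ` points X"
proof
  show "points (quotient_fspace X q) \<subseteq> q ` points X"
    using openin_quotient_fspace[of X q "points (quotient_fspace X q)"] by simp
  have "{x \<in> points X. q x \<in> q ` points X} = points X" by auto
  then have "openin (space_top (quotient_fspace X q)) (q ` points X)"
    by (simp add: openin_quotient_fspace)
  then show "q ` points X \<subseteq> points (quotient_fspace X q)"
    by (rule openin_subset)
qed

section \<open>Subvarieties of (multi)projective spaces\<close>

text \<open>Polynomials with coefficients in the complex numbers are finitely supported functions from
  monomials, the monomials being finitely supported functions from variables to exponents.\<close>

type_synonym 'i mpoly = "('i \<Rightarrow>\<^sub>0 nat) \<Rightarrow>\<^sub>0 complex"

definition poly_eval :: "'i mpoly \<Rightarrow> ('i \<Rightarrow> complex) \<Rightarrow> complex" where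
  "poly_eval F x =
     (\<Sum>m\<in>Poly_Mapping.keys F. Poly_Mapping.lookup F m *
        (\<Prod>i\<in>Poly_Mapping.keys m. x i ^ Poly_Mapping.lookup m i))"

text \<open>The variables are indexed by \<open>I\<close> and partitioned into blocks by \<open>b\<close>; \<open>F\<close> is multihomogeneous of
  multidegree \<open>d\<close> if it is homogeneous of degree \<open>d j\<close> in the variables of every block \<open>j\<close>. A
  constant \<open>b\<close> gives ordinary homogeneous polynomials.\<close>

definition multihomogeneous ::
    "'i set \<Rightarrow> ('i \<Rightarrow> 'j) \<Rightarrow> ('j \<Rightarrow> nat) \<Rightarrow> 'i mpoly \<Rightarrow> bool" where
  "multihomogeneous I b d F \<longleftrightarrow>
     (\<forall>m\<in>Poly_Mapping.keys F. Poly_Mapping.keys m \<subseteq> I \<and>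
        (\<forall>j. (\<Sum>i\<in>{i \<in> Poly_Mapping.keys m. b i = j}. Poly_Mapping.lookup m i) = d j))"

text \<open>A set \<open>X\<close> of points of a (multi)projective space, with the induced structure. The set
  \<open>crd P\<close> consists of all systems of (multi)homogeneous coordinates of the point \<open>P\<close>. The Zariski
  topology is generated by the complements of hypersurfaces; regular functions are locally quotients
  of polynomials of the same (multi)degree. If \<open>X\<close> is locally closed, this is the usual structure of a
  quasi-projective variety (and an \<open>X\<close> isomorphic to a variety is automatically locally
  closed).\<close>

definition zariski_top ::
    "'i set \<Rightarrow> ('i \<Rightarrow> 'j) \<Rightarrow> ('p \<Rightarrow> ('i \<Rightarrow> complex) set) \<Rightarrow> 'p set \<Rightarrow> 'p topology" where
  "zariski_top I b crd X =
     topology_generated_by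
       {{P \<in> X. \<forall>x\<in>crd P. poly_eval F x \<noteq> 0} | F. \<exists>d. multihomogeneous I b d F}"

definition induced_variety ::
    "'i set \<Rightarrow> ('i \<Rightarrow> 'j) \<Rightarrow> ('p \<Rightarrow> ('i \<Rightarrow> complex) set) \<Rightarrow> 'p set \<Rightarrow> 'p fspace" where
  "induced_variety I b crd X =
     \<lparr>space_top = zariski_top I b crd X,
      regular = (\<lambda>U f. \<forall>P\<in>U. \<exists>W F G d. openin (zariski_top I b crd X) W \<and> P \<in> W \<and> W \<subseteq> U \<and>
        multihomogeneous I b d F \<and> multihomogeneous I b d G \<and>
        (\<forall>Q\<in>W. \<forall>x\<in>crd Q. poly_eval G x \<noteq> 0 \<and> f Q = poly_eval F x / poly_eval G x))\<rparr>"

lemma points_induced_variety: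
  fixes I :: "'a set"
  shows "points (induced_variety I b crd X) = X"
proof -
  define one :: "'a mpoly" where "one = Poly_Mapping.single 0 1"
  have "multihomogeneous I b (\<lambda>_. 0) one"
    by (simp add: multihomogeneous_def one_def)
  moreover have "X = {P \<in> X. \<forall>x\<in>crd P. poly_eval one x \<noteq> 0}"
    by (simp add: poly_eval_def one_def)
  ultimately have
    "X \<in> {{P \<in> X. \<forall>x\<in>crd P. poly_eval F x \<noteq> 0} | F. \<exists>d. multihomogeneous I b d F}"
    by blast
  then have "\<Union> {{P \<in> X. \<forall>x\<in>crd P. poly_eval F x \<noteq> 0} | F. \<exists>d. multihomogeneous I b d F} = X"
    by (intro equalityI Union_least Union_upper) auto
  then show ?thesis
    by (simp only: induced_variety_def zariski_top_def topology_generated_by_topspace fspace.simps)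
qed

section \<open>Coordinate spaces, projective spaces and Grassmannians\<close>

text \<open>Vectors with coordinates indexed by \<open>I\<close> are functions vanishing outside \<open>I\<close>. The vector space
  operations on functions are pointwise.\<close>

definition coord_space :: "'i set \<Rightarrow> ('i \<Rightarrow> complex) set" where
  "coord_space I = {x. \<forall>i. i \<notin> I \<longrightarrow> x i = 0}"

definition cscale :: "complex \<Rightarrow> ('i \<Rightarrow> complex) \<Rightarrow> ('i \<Rightarrow> complex)" where
  "cscale c x = (\<lambda>i. c * x i)"

interpretation cvec: vector_space "cscale :: complex \<Rightarrow> ('i \<Rightarrow> complex) \<Rightarrow> ('i \<Rightarrow> complex)"
  by unfold_locales (auto simp: cscale_def fun_eq_iff algebra_simps)

text \<open>A point of projective space is the set of all its homogeneous coordinate vectors.\<close>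

definition proj_point :: "('i \<Rightarrow> complex) \<Rightarrow> ('i \<Rightarrow> complex) set" where
  "proj_point x = {cscale c x | c. c \<noteq> 0}"

definition proj_space :: "'i set \<Rightarrow> ('i \<Rightarrow> complex) set set" where
  "proj_space I = proj_point ` (coord_space I - {0})"

definition projective_subvariety ::
    "'i set \<Rightarrow> ('i \<Rightarrow> complex) set set \<Rightarrow> ('i \<Rightarrow> complex) set fspace" where
  "projective_subvariety I X = induced_variety I (\<lambda>_. ()) (\<lambda>P. P) X"

definition Gr2 :: "nat \<Rightarrow> (nat \<Rightarrow> complex) set set" where
  "Gr2 n = {V. cvec.subspace V \<and> V \<subseteq> coord_space {1..n} \<and> cvec.dim V = 2}"

definition minor2 :: "(nat \<Rightarrow> complex) \<Rightarrow> (nat \<Rightarrow> complex) \<Rightarrow> nat \<Rightarrow> nat \<Rightarrow> complex" where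
  "minor2 u v i j = u i * v j - u j * v i"

text \<open>The two rows of a matrix representative of a \<open>2\<close>-dimensional subspace. The choice affects the
  Pluecker coordinates only by a common nonzero factor.\<close>

definition representative ::
    "(nat \<Rightarrow> complex) set \<Rightarrow> (nat \<Rightarrow> complex) \<times> (nat \<Rightarrow> complex)" where
  "representative V = (SOME (u, v). cvec.span {u, v} = V)"

definition pluecker :: "(nat \<Rightarrow> complex) set \<Rightarrow> nat \<Rightarrow> nat \<Rightarrow> complex" where
  "pluecker V = (case representative V of (u, v) \<Rightarrow> minor2 u v)"

lemma minor2_span:
  assumes "{u, v} \<subseteq> cvec.span {a, b}"
  shows "\<exists>c. \<forall>i j. minor2 u v i j = c * minor2 a b i j"
proof -
  have *: "\<exists>s t. \<forall>i. w i = s * a i + t * b i" if "w \<in> cvec.span {a, b}" for w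
  proof -
    from that obtain s where s: "w - cscale s a \<in> cvec.span {b}"
      by (auto simp: cvec.span_breakdown_eq[of w a])
    then obtain t where "w - cscale s a = cscale t b"
      by (auto simp: cvec.span_singleton)
    then have "w = cscale s a + cscale t b"
      by (simp add: algebra_simps)
    then show ?thesis
      by (intro exI[of _ s] exI[of _ t]) (simp add: cscale_def)
  qed
  obtain s t where "\<And>i. u i = s * a i + t * b i"
    using *[of u] assms by auto
  moreover obtain s' t' where "\<And>i. v i = s' * a i + t' * b i"
    using *[of v] assms by auto
  ultimately have "minor2 u v i j = (s * t' - t * s') * minor2 a b i j" for i j
    by (simp add: minor2_def algebra_simps)
  then show ?thesis by blast
qed

lemma pluecker_unique:
  assumes "cvec.span {u, v} = V"
  shows "\<exists>c. c \<noteq> 0 \<and> (\<forall>i j. minor2 u v i j = c * pluecker V i j)"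
proof -
  obtain a b where ab: "representative V = (a, b)" by (rule prod.exhaust)
  have "case representative V of (u, v) \<Rightarrow> cvec.span {u, v} = V"
    unfolding representative_def
    by (rule someI[where P = "\<lambda>(u, v). cvec.span {u, v} = V" and x = "(u, v)"]) (simp add: assms)
  with ab have V: "cvec.span {a, b} = V" by simp
  have "{u, v} \<subseteq> cvec.span {a, b}" "{a, b} \<subseteq> cvec.span {u, v}"
    using V assms cvec.span_superset[of "{a, b}"] cvec.span_superset[of "{u, v}"] by auto
  then obtain c c' where c: "\<And>i j. minor2 u v i j = c * minor2 a b i j"
    and c': "\<And>i j. minor2 a b i j = c' * minor2 u v i j"
    using minor2_span[of u v a b] minor2_span[of a b u v] by blast
  have p: "pluecker V = minor2 a b" by (simp add: pluecker_def ab)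
  show ?thesis
  proof (cases "c = 0")
    case True
    then have "\<forall>i j. minor2 u v i j = 1 * pluecker V i j"
      using c c' p by simp
    then show ?thesis by (intro exI[of _ 1]) simp
  qed (use c p in auto)
qed

section \<open>The open Parke--Taylor variety\<close>

definition Sigma_perms :: "nat \<Rightarrow> (nat \<Rightarrow> nat) set" where
  "Sigma_perms n = {\<sigma>. \<sigma> permutes {1..n} \<and> \<sigma> 1 = 1 \<and> \<sigma> 2 = 2}"

text \<open>For \<open>i \<in> {1..n}\<close> the cyclic successor of \<open>i\<close> is \<open>i mod n + 1\<close>.\<close>

definition parke_taylor :: "nat \<Rightarrow> (nat \<Rightarrow> complex) set \<Rightarrow> (nat \<Rightarrow> nat) \<Rightarrow> complex" where
  "parke_taylor n V \<sigma> = (\<Prod>i=1..n. 1 / pluecker V (\<sigma> i) (\<sigma> (i mod n + 1)))"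

definition PT_map :: "nat \<Rightarrow> (nat \<Rightarrow> complex) set \<Rightarrow> ((nat \<Rightarrow> nat) \<Rightarrow> complex) set" where
  "PT_map n V = proj_point (\<lambda>\<sigma>. if \<sigma> \<in> Sigma_perms n then parke_taylor n V \<sigma> else 0)"

definition Gr2_open :: "nat \<Rightarrow> (nat \<Rightarrow> complex) set set" where
  "Gr2_open n = {V \<in> Gr2 n. \<forall>i\<in>{1..n}. \<forall>j\<in>{1..n}. i \<noteq> j \<longrightarrow> pluecker V i j \<noteq> 0}"

definition PT_open :: "nat \<Rightarrow> ((nat \<Rightarrow> nat) \<Rightarrow> complex) set fspace" where
  "PT_open n = projective_subvariety (Sigma_perms n) (PT_map n ` Gr2_open n)"

section \<open>The moduli space of marked points on the projective line\<close>

abbreviation P1 :: "(nat \<Rightarrow> complex) set set" where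
  "P1 \<equiv> proj_space {0, 1}"

text \<open>Ordered \<open>n\<close>-tuples of distinct points, an open subvariety of the \<open>n\<close>-fold product of the
  projective line. The coordinates \<open>(j, 0), (j, 1)\<close> are homogeneous coordinates of the \<open>j\<close>-th
  point.\<close>

definition config_space :: "nat \<Rightarrow> (nat \<Rightarrow> (nat \<Rightarrow> complex) set) fspace" where
  "config_space n =
     induced_variety ({1..n} \<times> {0, 1}) fst
       (\<lambda>a. {x \<in> coord_space ({1..n} \<times> {0, 1}). \<forall>j\<in>{1..n}. (\<lambda>k. x (j, k)) \<in> a j})
       {a \<in> {1..n} \<rightarrow>\<^sub>E P1. inj_on a {1..n}}"

text \<open>The action of the invertible matrix with rows \<open>(a, b)\<close> and \<open>(c, d)\<close> on the projective
  line.\<close>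

definition proj_transform ::
    "complex \<Rightarrow> complex \<Rightarrow> complex \<Rightarrow> complex \<Rightarrow> (nat \<Rightarrow> complex) set \<Rightarrow> (nat \<Rightarrow> complex) set" where
  "proj_transform a b c d P =
     (\<lambda>x k. if k = 0 then a * x 0 + b * x 1 else if k = 1 then c * x 0 + d * x 1 else 0) ` P"

definition PGL2 :: "((nat \<Rightarrow> complex) set \<Rightarrow> (nat \<Rightarrow> complex) set) set" where
  "PGL2 = {proj_transform a b c d | a b c d. a * d - b * c \<noteq> 0}"

definition PGL2_orbit ::
    "nat \<Rightarrow> (nat \<Rightarrow> (nat \<Rightarrow> complex) set) \<Rightarrow> (nat \<Rightarrow> (nat \<Rightarrow> complex) set) set" where
  "PGL2_orbit n a = {(\<lambda>j\<in>{1..n}. g (a j)) | g. g \<in> PGL2}"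

definition M0 :: "nat \<Rightarrow> (nat \<Rightarrow> (nat \<Rightarrow> complex) set) set fspace" where
  "M0 n = quotient_fspace (config_space n) (PGL2_orbit n)"

end

theory Submission
  imports Defs
begin

text \<open>
  The columns of a \<open>2 \<times> n\<close> matrix with nonzero Pluecker coordinates are homogeneous coordinates of \<open>n\<close>
  distinct points of the projective line. Rescaling a column or applying a projective transformation
  multiplies all Parke--Taylor functions by a common factor, because every index occurs in exactly
  two of the factors \<open>p i j\<close> (\<open>parke_taylor_vector_rescale\<close>). So the Parke--Taylor point depends only
  on the orbit of the configuration, which gives a map \<open>\<kappa>\<close> from configurations onto the open
  Parke--Taylor variety. After clearing denominators \<open>\<kappa>\<close> is given by multihomogeneous polynomials of
  equal multidegree (\<open>mhom_fun_parke_taylor_poly\<close>), hence it is a morphism.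

  Conversely, the quotient of the Parke--Taylor functions of two permutations that differ by an
  adjacent transposition is, up to sign, the cross-ratio of the four points involved
  (\<open>parke_taylor_vector_swap\<close>). Products of at most two such quotients give the cross-ratio of the
  points \<open>1, 2, 3, j\<close> for every \<open>j\<close> (\<open>parke_taylor_normal_form\<close>), so the configuration normalised by
  sending the points \<open>1, 2, 3\<close> to \<open>[1 : 0], [0 : 1], [1 : 1]\<close> is a morphism \<open>s\<close> from the open
  Parke--Taylor variety to the configuration space (\<open>ex_normal_form_morphism\<close>). As \<open>s (\<kappa> a)\<close> is a
  projective transform of \<open>a\<close> and \<open>\<kappa>\<close> is invariant, \<open>\<kappa> \<circ> s\<close> is the identity, and
  \<open>isomorphic_quotient_fspace\<close> yields inverse isomorphisms with the space of orbits.
\<close>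

section \<open>Multihomogeneous polynomial functions\<close>

text \<open>A monomial \<open>m\<close> as a function of the values of the variables.\<close>

definition monom_val :: "('i \<Rightarrow>\<^sub>0 nat) \<Rightarrow> ('i \<Rightarrow> complex) \<Rightarrow> complex" where
  "monom_val m x = (\<Prod>i\<in>Poly_Mapping.keys m. x i ^ Poly_Mapping.lookup m i)"

text \<open>The degree of the monomial \<open>m\<close> in the variables of the block \<open>j\<close>.\<close>

definition block_degree :: "('i \<Rightarrow> 'j) \<Rightarrow> ('i \<Rightarrow>\<^sub>0 nat) \<Rightarrow> 'j \<Rightarrow> nat" where
  "block_degree b m j = (\<Sum>i\<in>{i \<in> Poly_Mapping.keys m. b i = j}. Poly_Mapping.lookup m i)"

lemma multihomogeneous_iff:
  "multihomogeneous I b d F \<longleftrightarrow>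
     (\<forall>m\<in>Poly_Mapping.keys F. Poly_Mapping.keys m \<subseteq> I \<and> block_degree b m = d)"
  by (auto simp: multihomogeneous_def block_degree_def fun_eq_iff)

lemma poly_eval_superset:
  assumes "finite S" "Poly_Mapping.keys F \<subseteq> S"
  shows "poly_eval F x = (\<Sum>m\<in>S. Poly_Mapping.lookup F m * monom_val m x)"
  unfolding poly_eval_def monom_val_def
  by (rule sum.mono_neutral_left) (use assms in \<open>auto simp: in_keys_iff\<close>)

lemma poly_eval_monom_val:
  "poly_eval F x = (\<Sum>m\<in>Poly_Mapping.keys F. Poly_Mapping.lookup F m * monom_val m x)"
  by (simp add: poly_eval_superset)

lemma poly_eval_add: "poly_eval (F + G) x = poly_eval F x + poly_eval G x"
proof -
  let ?S = "Poly_Mapping.keys F \<union> Poly_Mapping.keys G"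
  have "poly_eval F x = (\<Sum>m\<in>?S. Poly_Mapping.lookup F m * monom_val m x)"
    "poly_eval G x = (\<Sum>m\<in>?S. Poly_Mapping.lookup G m * monom_val m x)"
    "poly_eval (F + G) x = (\<Sum>m\<in>?S. Poly_Mapping.lookup (F + G) m * monom_val m x)"
    using Poly_Mapping.keys_add[of F G] by (auto intro!: poly_eval_superset)
  then show ?thesis
    by (simp add: lookup_add algebra_simps sum.distrib)
qed

lemma poly_eval_single: "poly_eval (Poly_Mapping.single m c) x = c * monom_val m x"
  by (simp add: poly_eval_superset[of "{m}"])

lemma monom_val_superset:
  assumes "finite S" "Poly_Mapping.keys m \<subseteq> S"
  shows "monom_val m x = (\<Prod>i\<in>S. x i ^ Poly_Mapping.lookup m i)"
  unfolding monom_val_def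
  by (rule prod.mono_neutral_left) (use assms in \<open>auto simp: in_keys_iff\<close>)

lemma block_degree_superset:
  assumes "finite S" "Poly_Mapping.keys m \<subseteq> S"
  shows "block_degree b m j = (\<Sum>i\<in>{i \<in> S. b i = j}. Poly_Mapping.lookup m i)"
  unfolding block_degree_def
  by (rule sum.mono_neutral_left) (use assms in \<open>auto simp: in_keys_iff\<close>)

lemma monom_val_add: "monom_val (m + m') x = monom_val m x * monom_val m' x"
  using Poly_Mapping.keys_add[of m m']
  by (simp add: monom_val_superset[of "Poly_Mapping.keys m \<union> Poly_Mapping.keys m'"] lookup_add
      power_add prod.distrib)

lemma block_degree_add: "block_degree b (m + m') j = block_degree b m j + block_degree b m' j"
  using Poly_Mapping.keys_add[of m m']
  by (simp add: block_degree_superset[of "Poly_Mapping.keys m \<union> Poly_Mapping.keys m'"] lookup_add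
      sum.distrib)

text \<open>The functions given by multihomogeneous polynomials of multidegree \<open>d\<close>. Working with these functions
  instead of the polynomials turns substitution of polynomials into composition of functions. The
  zero function has every multidegree.\<close>

definition mhom_fun ::
    "'i set \<Rightarrow> ('i \<Rightarrow> 'j) \<Rightarrow> ('j \<Rightarrow> nat) \<Rightarrow> (('i \<Rightarrow> complex) \<Rightarrow> complex) \<Rightarrow> bool" where
  "mhom_fun I b d f \<longleftrightarrow> (\<exists>F. multihomogeneous I b d F \<and> (\<forall>x. f x = poly_eval F x))"

lemma mhom_fun_monom:
  assumes "Poly_Mapping.keys m \<subseteq> I" "block_degree b m = d"
  shows "mhom_fun I b d (\<lambda>x. c * monom_val m x)"
  unfolding mhom_fun_def multihomogeneous_iff
  by (intro exI[of _ "Poly_Mapping.single m c"]) (use assms in \<open>auto simp: poly_eval_single\<close>)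

lemma mhom_fun_zero: "mhom_fun I b d (\<lambda>x. 0)"
  unfolding mhom_fun_def multihomogeneous_def
  by (intro exI[of _ 0]) (simp add: poly_eval_def)

lemma mhom_fun_add:
  assumes "mhom_fun I b d f" "mhom_fun I b d g"
  shows "mhom_fun I b d (\<lambda>x. f x + g x)"
proof -
  obtain F G where "multihomogeneous I b d F" "\<And>x. f x = poly_eval F x"
    "multihomogeneous I b d G" "\<And>x. g x = poly_eval G x"
    using assms by (auto simp: mhom_fun_def)
  moreover have "multihomogeneous I b d (F + G)"
    using \<open>multihomogeneous I b d F\<close> \<open>multihomogeneous I b d G\<close> Poly_Mapping.keys_add[of F G]
    unfolding multihomogeneous_def by blast
  ultimately show ?thesis
    unfolding mhom_fun_def by (intro exI[of _ "F + G"]) (simp add: poly_eval_add)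
qed

lemma mhom_fun_sum:
  assumes "\<And>a. a \<in> A \<Longrightarrow> mhom_fun I b d (f a)"
  shows "mhom_fun I b d (\<lambda>x. \<Sum>a\<in>A. f a x)"
  using assms
  by (induction A rule: infinite_finite_induct) (auto intro!: mhom_fun_zero mhom_fun_add)

lemma mhom_fun_const: "mhom_fun I b (\<lambda>_. 0) (\<lambda>x. c)"
  using mhom_fun_monom[of 0 I b "\<lambda>_. 0" c]
  by (simp add: block_degree_def monom_val_def fun_eq_iff)

lemma mhom_fun_var:
  assumes "i \<in> I"
  shows "mhom_fun I b (\<lambda>j. if j = b i then 1 else 0) (\<lambda>x. x i)"
proof -
  have "block_degree b (Poly_Mapping.single i 1) j = (if j = b i then 1 else 0)" for j
    by (auto simp: block_degree_superset[of "{i}"] Collect_conv_if)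
  then show ?thesis
    using mhom_fun_monom[of "Poly_Mapping.single i 1" I b _ 1] assms
    by (simp add: fun_eq_iff monom_val_superset[of "{i}"])
qed

lemma mhom_fun_mult:
  assumes "mhom_fun I b d f" "mhom_fun I b e g"
  shows "mhom_fun I b (\<lambda>j. d j + e j) (\<lambda>x. f x * g x)"
proof -
  obtain F G where F: "multihomogeneous I b d F" "\<And>x. f x = poly_eval F x"
    and G: "multihomogeneous I b e G" "\<And>x. g x = poly_eval G x"
    using assms by (auto simp: mhom_fun_def)
  have "(\<lambda>x. f x * g x) = (\<lambda>x. \<Sum>m\<in>Poly_Mapping.keys F. \<Sum>m'\<in>Poly_Mapping.keys G.
      (Poly_Mapping.lookup F m * Poly_Mapping.lookup G m') * monom_val (m + m') x)"
    by (simp add: F G poly_eval_monom_val sum_product monom_val_add mult_ac)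
  moreover have "mhom_fun I b (\<lambda>j. d j + e j) \<dots>"
  proof (intro mhom_fun_sum mhom_fun_monom)
    fix m m' assume m: "m \<in> Poly_Mapping.keys F" "m' \<in> Poly_Mapping.keys G"
    show "Poly_Mapping.keys (m + m') \<subseteq> I"
      using m F(1) G(1) Poly_Mapping.keys_add[of m m'] by (fastforce simp: multihomogeneous_def)
    show "block_degree b (m + m') = (\<lambda>j. d j + e j)"
      using m F(1) G(1) by (auto simp: multihomogeneous_iff block_degree_add fun_eq_iff)
  qed
  ultimately show ?thesis by simp
qed

lemma mhom_fun_cmult: "mhom_fun I b d f \<Longrightarrow> mhom_fun I b d (\<lambda>x. c * f x)"
  using mhom_fun_mult[OF mhom_fun_const[of I b c]] by simp

lemma mhom_fun_diff:
  assumes "mhom_fun I b d f" "mhom_fun I b d g"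
  shows "mhom_fun I b d (\<lambda>x. f x - g x)"
  using mhom_fun_add[OF assms(1) mhom_fun_cmult[OF assms(2), of "-1"]] by simp

lemma mhom_fun_power:
  assumes "mhom_fun I b d f"
  shows "mhom_fun I b (\<lambda>j. k * d j) (\<lambda>x. f x ^ k)"
proof (induction k)
  case 0
  then show ?case using mhom_fun_const[of I b 1] by simp
next
  case (Suc k)
  then show ?case using mhom_fun_mult[OF assms Suc] by simp
qed

lemma mhom_fun_prod:
  assumes "\<And>a. a \<in> A \<Longrightarrow> mhom_fun I b (d a) (f a)"
  shows "mhom_fun I b (\<lambda>j. \<Sum>a\<in>A. d a j) (\<lambda>x. \<Prod>a\<in>A. f a x)"
  using assms
proof (induction A rule: infinite_finite_induct)
  case (insert a A)
  then show ?case by (simp add: mhom_fun_mult)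
qed (auto intro: mhom_fun_const)

text \<open>Weights that are constant on the blocks enter a monomial only through its multidegree: here
  additively, and in the next lemma multiplicatively.\<close>

lemma sum_block_degree:
  assumes "finite I" "Poly_Mapping.keys m \<subseteq> I"
  shows "(\<Sum>i\<in>Poly_Mapping.keys m. Poly_Mapping.lookup m i * h (b i)) =
     (\<Sum>j\<in>b ` I. block_degree b m j * h j)"
proof -
  have "(\<Sum>j\<in>b ` I. block_degree b m j * h j) =
     (\<Sum>j\<in>b ` I. \<Sum>i\<in>{i \<in> Poly_Mapping.keys m. b i = j}. Poly_Mapping.lookup m i * h (b i))"
    by (simp add: block_degree_def sum_distrib_right)
  also have "\<dots> = (\<Sum>i\<in>Poly_Mapping.keys m. Poly_Mapping.lookup m i * h (b i))"
    using assms by (intro sum.group) auto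
  finally show ?thesis by simp
qed

lemma prod_block_degree:
  fixes c :: "'j \<Rightarrow> complex"
  assumes "finite I" "Poly_Mapping.keys m \<subseteq> I"
  shows "(\<Prod>i\<in>Poly_Mapping.keys m. c (b i) ^ Poly_Mapping.lookup m i) =
     (\<Prod>j\<in>b ` I. c j ^ block_degree b m j)"
proof -
  have "(\<Prod>j\<in>b ` I. c j ^ block_degree b m j) =
     (\<Prod>j\<in>b ` I. \<Prod>i\<in>{i \<in> Poly_Mapping.keys m. b i = j}. c (b i) ^ Poly_Mapping.lookup m i)"
    by (simp add: block_degree_def power_sum)
  also have "\<dots> = (\<Prod>i\<in>Poly_Mapping.keys m. c (b i) ^ Poly_Mapping.lookup m i)"
    using assms by (intro prod.group) auto
  finally show ?thesis by simp
qed

lemma mhom_fun_scale: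
  assumes "finite I" "mhom_fun I b d f" "\<And>i. i \<in> I \<Longrightarrow> y i = c (b i) * x i"
  shows "f y = (\<Prod>j\<in>b ` I. c j ^ d j) * f x"
proof -
  obtain F where F: "multihomogeneous I b d F" "\<And>x. f x = poly_eval F x"
    using assms by (auto simp: mhom_fun_def)
  have "monom_val m y = (\<Prod>j\<in>b ` I. c j ^ d j) * monom_val m x" if "m \<in> Poly_Mapping.keys F" for m
  proof -
    have m: "Poly_Mapping.keys m \<subseteq> I" "block_degree b m = d"
      using that F(1) by (auto simp: multihomogeneous_iff)
    have "monom_val m y =
        (\<Prod>i\<in>Poly_Mapping.keys m. c (b i) ^ Poly_Mapping.lookup m i * x i ^ Poly_Mapping.lookup m i)"
      unfolding monom_val_def using m(1) assms(3)
      by (intro prod.cong) (auto simp: power_mult_distrib)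
    then show ?thesis
      using prod_block_degree[OF assms(1) m(1), of c b] m(2) by (simp add: prod.distrib monom_val_def)
  qed
  then show ?thesis
    by (simp add: F(2) poly_eval_monom_val sum_distrib_left mult_ac)
qed

text \<open>Substituting for every variable of block \<open>j\<close> a polynomial of multidegree \<open>D j\<close> turns a
  multihomogeneous polynomial of multidegree \<open>e\<close> into one of multidegree \<open>\<Sum>j. e j * D j\<close>.\<close>

lemma mhom_fun_subst:
  assumes "finite J" "multihomogeneous J b' e F"
    and T: "\<And>i. i \<in> J \<Longrightarrow> mhom_fun I b (D (b' i)) (\<lambda>x. T x i)"
  shows "mhom_fun I b (\<lambda>l. \<Sum>j\<in>b' ` J. e j * D j l) (\<lambda>x. poly_eval F (T x))"
  unfolding poly_eval_monom_val
proof (intro mhom_fun_sum mhom_fun_cmult)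
  fix m assume "m \<in> Poly_Mapping.keys F"
  then have m: "Poly_Mapping.keys m \<subseteq> J" "block_degree b' m = e"
    using assms(2) by (auto simp: multihomogeneous_iff)
  have "mhom_fun I b (\<lambda>l. \<Sum>i\<in>Poly_Mapping.keys m. Poly_Mapping.lookup m i * D (b' i) l)
      (\<lambda>x. monom_val m (T x))"
    unfolding monom_val_def using m(1) by (intro mhom_fun_prod mhom_fun_power T) auto
  then show "mhom_fun I b (\<lambda>l. \<Sum>j\<in>b' ` J. e j * D j l) (\<lambda>x. monom_val m (T x))"
    using sum_block_degree[OF assms(1) m(1), of "\<lambda>j. D j _" b'] m(2) by simp
qed

section \<open>Morphisms given by polynomials, and quotients\<close>

text \<open>A map that is given in coordinates by multihomogeneous polynomials, of the same multidegree within
  each block of target coordinates, is a morphism. The last hypothesis says that the coordinate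
  systems of a point of the target differ by a nonzero factor in each block, so that the
  nonvanishing of a multihomogeneous polynomial can be tested on any one of them.\<close>

lemma morphism_induced_variety:
  assumes J: "finite J"
    and \<phi>: "\<And>P. P \<in> X \<Longrightarrow> \<phi> P \<in> Y"
    and ne: "\<And>P. P \<in> X \<Longrightarrow> crd P \<noteq> {}"
    and T: "\<And>i. i \<in> J \<Longrightarrow> mhom_fun I b (D (b' i)) (\<lambda>x. T x i)"
    and crd: "\<And>P x. P \<in> X \<Longrightarrow> x \<in> crd P \<Longrightarrow> T x \<in> crd' (\<phi> P)"
    and sc: "\<And>Q y y'. Q \<in> Y \<Longrightarrow> y \<in> crd' Q \<Longrightarrow> y' \<in> crd' Q \<Longrightarrow>
        \<exists>c. (\<forall>j. c j \<noteq> 0) \<and> (\<forall>i\<in>J. y' i = c (b' i) * y i)"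
  shows "morphism (induced_variety I b crd X) (induced_variety J b' crd' Y) \<phi>"
proof -
  let ?X = "induced_variety I b crd X" and ?Y = "induced_variety J b' crd' Y"
  have topX: "space_top ?X = zariski_top I b crd X" and topY: "space_top ?Y = zariski_top J b' crd' Y"
    by (simp_all add: induced_variety_def)
  have tX: "topspace (zariski_top I b crd X) = X" and tY: "topspace (zariski_top J b' crd' Y) = Y"
    using points_induced_variety[of I b crd X] points_induced_variety[of J b' crd' Y]
    by (simp_all add: topX topY)
  have subst: "\<exists>G. multihomogeneous I b (\<lambda>l. \<Sum>j\<in>b' ` J. e j * D j l) G \<and>
      (\<forall>x. poly_eval F (T x) = poly_eval G x)" if "multihomogeneous J b' e F" for e F
    using mhom_fun_subst[where D=D and T=T, OF J that T] unfolding mhom_fun_def by blast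
  have cont: "continuous_map (zariski_top I b crd X) (zariski_top J b' crd' Y) \<phi>"
    unfolding zariski_top_def[of J] continuous_on_generated_topo_iff
  proof (intro conjI allI impI)
    fix U
    assume "U \<in> {{P \<in> Y. \<forall>x\<in>crd' P. poly_eval F x \<noteq> 0} | F. \<exists>d. multihomogeneous J b' d F}"
    then obtain F e where F: "multihomogeneous J b' e F"
      and U: "U = {P \<in> Y. \<forall>x\<in>crd' P. poly_eval F x \<noteq> 0}" by blast
    obtain G where G: "multihomogeneous I b (\<lambda>l. \<Sum>j\<in>b' ` J. e j * D j l) G"
      "\<And>x. poly_eval F (T x) = poly_eval G x" using subst[OF F] by blast
    have "\<phi> P \<in> U \<longleftrightarrow> (\<forall>x\<in>crd P. poly_eval G x \<noteq> 0)" if P: "P \<in> X" for P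
    proof
      assume "\<phi> P \<in> U"
      then show "\<forall>x\<in>crd P. poly_eval G x \<noteq> 0"
        using crd[OF P] by (auto simp: U simp flip: G(2))
    next
      assume nz: "\<forall>x\<in>crd P. poly_eval G x \<noteq> 0"
      obtain x where x: "x \<in> crd P" using ne[OF P] by blast
      have "poly_eval F y \<noteq> 0" if y: "y \<in> crd' (\<phi> P)" for y
      proof -
        obtain c where c: "\<And>j. c j \<noteq> 0" "\<And>i. i \<in> J \<Longrightarrow> y i = c (b' i) * T x i"
          using sc[OF \<phi>[OF P] crd[OF P x] y] by blast
        have "mhom_fun J b' e (poly_eval F)" using F by (auto simp: mhom_fun_def)
        then have "poly_eval F y = (\<Prod>j\<in>b' ` J. c j ^ e j) * poly_eval F (T x)"
          by (rule mhom_fun_scale[OF J]) (rule c(2))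
        then show ?thesis using nz x J c(1) by (simp add: G(2))
      qed
      then show "\<phi> P \<in> U" using \<phi>[OF P] by (simp add: U)
    qed
    then have "\<phi> -` U \<inter> topspace (zariski_top I b crd X) = {P \<in> X. \<forall>x\<in>crd P. poly_eval G x \<noteq> 0}"
      unfolding tX by blast
    also have "openin (zariski_top I b crd X) \<dots>"
      unfolding zariski_top_def using G(1) by (intro topology_generated_by_Basis) blast
    finally show "openin (zariski_top I b crd X) (\<phi> -` U \<inter> topspace (zariski_top I b crd X))" .
  next
    show "\<phi> ` topspace (zariski_top I b crd X) \<subseteq>
      \<Union>{{P \<in> Y. \<forall>x\<in>crd' P. poly_eval F x \<noteq> 0} | F. \<exists>d. multihomogeneous J b' d F}"
      unfolding topology_generated_by_topspace[symmetric] zariski_top_def[of J, symmetric] tX tY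
      using \<phi> by blast
  qed
  show ?thesis
    unfolding morphism_def topX topY tX
  proof (intro conjI cont allI impI)
    fix V g
    assume V: "openin (zariski_top J b' crd' Y) V \<and> regular ?Y V g"
    show "regular ?X {x \<in> X. \<phi> x \<in> V} (g \<circ> \<phi>)"
      unfolding induced_variety_def fspace.simps
    proof
      fix P assume "P \<in> {x \<in> X. \<phi> x \<in> V}"
      then have P: "P \<in> X" "\<phi> P \<in> V" by auto
      then obtain W F G d where W: "openin (zariski_top J b' crd' Y) W" "\<phi> P \<in> W" "W \<subseteq> V"
        and F: "multihomogeneous J b' d F" and G: "multihomogeneous J b' d G"
        and g: "\<forall>Q\<in>W. \<forall>x\<in>crd' Q. poly_eval G x \<noteq> 0 \<and> g Q = poly_eval F x / poly_eval G x"
        using V unfolding induced_variety_def fspace.simps by blast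
      obtain F' G' where F': "multihomogeneous I b (\<lambda>l. \<Sum>j\<in>b' ` J. d j * D j l) F'"
          "\<And>x. poly_eval F (T x) = poly_eval F' x"
        and G': "multihomogeneous I b (\<lambda>l. \<Sum>j\<in>b' ` J. d j * D j l) G'"
          "\<And>x. poly_eval G (T x) = poly_eval G' x"
        using subst[OF F] subst[OF G] by blast
      have "openin (zariski_top I b crd X) {x \<in> X. \<phi> x \<in> W}"
        using openin_continuous_map_preimage[OF cont W(1)] by (simp add: tX)
      moreover have "\<forall>Q\<in>{x \<in> X. \<phi> x \<in> W}. \<forall>x\<in>crd Q.
          poly_eval G' x \<noteq> 0 \<and> (g \<circ> \<phi>) Q = poly_eval F' x / poly_eval G' x"
        using g crd by (auto simp flip: F'(2) G'(2))
      ultimately show "\<exists>W F G d. openin (zariski_top I b crd X) W \<and> P \<in> W \<and> W \<subseteq> {x \<in> X. \<phi> x \<in> V} \<and>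
          multihomogeneous I b d F \<and> multihomogeneous I b d G \<and>
          (\<forall>Q\<in>W. \<forall>x\<in>crd Q. poly_eval G x \<noteq> 0 \<and> (g \<circ> \<phi>) Q = poly_eval F x / poly_eval G x)"
        using F'(1) G'(1) W P by blast
    qed
  qed
qed

lemma regular_induced_variety_cong:
  assumes "\<And>P. P \<in> U \<Longrightarrow> f P = g P"
  shows "regular (induced_variety I b crd X) U f \<longleftrightarrow> regular (induced_variety I b crd X) U g"
proof -
  have "regular (induced_variety I b crd X) U f'"
    if "regular (induced_variety I b crd X) U f" "\<And>P. P \<in> U \<Longrightarrow> f P = f' P" for f f'
    using that unfolding induced_variety_def fspace.simps by (smt (verit, best) subset_iff)
  then show ?thesis using assms by metis
qed

text \<open>If \<open>\<kappa>: X \<rightarrow> Y\<close> is constant on the fibres of \<open>q\<close> and has a section \<open>s\<close> such that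
  \<open>s (\<kappa> x)\<close> always lies in the same fibre as \<open>x\<close>, then \<open>\<kappa>\<close> and \<open>s\<close> descend to inverse
  isomorphisms between \<open>Y\<close> and the quotient by \<open>q\<close>.\<close>

lemma isomorphic_quotient_fspace:
  assumes X: "X = induced_variety I b crd A"
    and \<kappa>: "morphism X Y \<kappa>" and s: "morphism Y X s"
    and \<kappa>s: "\<And>y. y \<in> points Y \<Longrightarrow> \<kappa> (s y) = y"
    and s\<kappa>: "\<And>x. x \<in> points X \<Longrightarrow> q (s (\<kappa> x)) = q x"
    and inv: "\<And>x x'. x \<in> points X \<Longrightarrow> x' \<in> points X \<Longrightarrow> q x = q x' \<Longrightarrow> \<kappa> x = \<kappa> x'"
  shows "isomorphic_varieties Y (quotient_fspace X q)"
proof -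
  let ?Q = "quotient_fspace X q"
  define k where "k y = \<kappa> (SOME x. x \<in> points X \<and> q x = y)" for y
  have kq: "k (q x) = \<kappa> x" if "x \<in> points X" for x
  proof -
    have "(SOME x'. x' \<in> points X \<and> q x' = q x) \<in> points X \<and>
        q (SOME x'. x' \<in> points X \<and> q x' = q x) = q x"
      using that by (intro someI[of "\<lambda>x'. x' \<in> points X \<and> q x' = q x"]) simp
    then show ?thesis unfolding k_def using inv that by blast
  qed
  have sX: "s y \<in> points X" if "y \<in> points Y" for y
    using s that by (auto simp: morphism_def continuous_map_def)
  have \<kappa>Y: "\<kappa> x \<in> points Y" if "x \<in> points X" for x
    using \<kappa> that by (auto simp: morphism_def continuous_map_def)
  have "morphism Y ?Q (q \<circ> s)"
    unfolding morphism_def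
  proof (intro conjI allI impI)
    have pre: "{y \<in> points Y. (q \<circ> s) y \<in> V} = {y \<in> points Y. s y \<in> {x \<in> points X. q x \<in> V}}" for V
      using sX by auto
    show "continuous_map (space_top Y) (space_top ?Q) (q \<circ> s)"
      unfolding continuous_map points_quotient_fspace
    proof (intro conjI allI impI)
      show "(q \<circ> s) ` points Y \<subseteq> q ` points X" using sX by auto
      fix V assume "openin (space_top ?Q) V"
      then have "openin (space_top X) {x \<in> points X. q x \<in> V}" by (simp add: openin_quotient_fspace)
      then show "openin (space_top Y) {y \<in> points Y. (q \<circ> s) y \<in> V}"
        unfolding pre using s unfolding morphism_def
        by (blast intro: openin_continuous_map_preimage)
    qed
    fix V g assume "openin (space_top ?Q) V \<and> regular ?Q V g"
    then have "openin (space_top X) {x \<in> points X. q x \<in> V}"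
        "regular X {x \<in> points X. q x \<in> V} (g \<circ> q)"
      by (simp_all add: openin_quotient_fspace) (simp add: quotient_fspace_def)
    then show "regular Y {y \<in> points Y. (q \<circ> s) y \<in> V} (g \<circ> (q \<circ> s))"
      unfolding pre comp_assoc[symmetric] using s unfolding morphism_def by blast
  qed
  moreover have "morphism ?Q Y k"
    unfolding morphism_def
  proof (intro conjI allI impI)
    have pre: "{x \<in> points X. q x \<in> {y \<in> q ` points X. k y \<in> V}} = {x \<in> points X. \<kappa> x \<in> V}" for V
      by (auto simp flip: kq)
    show "continuous_map (space_top ?Q) (space_top Y) k"
      unfolding continuous_map points_quotient_fspace
    proof (intro conjI allI impI)
      show "k ` q ` points X \<subseteq> points Y" using kq \<kappa>Y by auto
      fix V assume "openin (space_top Y) V"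
      then show "openin (space_top ?Q) {y \<in> q ` points X. k y \<in> V}"
        unfolding openin_quotient_fspace pre using \<kappa> unfolding morphism_def
        by (blast intro: openin_continuous_map_preimage)
    qed
    fix V g assume "openin (space_top Y) V \<and> regular Y V g"
    then have "regular X {x \<in> points X. \<kappa> x \<in> V} (g \<circ> \<kappa>)"
      using \<kappa> unfolding morphism_def by blast
    \<comment> \<open>\<open>k \<circ> q\<close> agrees with \<open>\<kappa>\<close> only on the points of \<open>X\<close>, so congruence of regularity is needed.\<close>
    then have "regular X {x \<in> points X. \<kappa> x \<in> V} (g \<circ> k \<circ> q)"
      unfolding X by (subst (asm) regular_induced_variety_cong[where g = "g \<circ> k \<circ> q"])
        (use kq X in auto)
    then have "regular ?Q {y \<in> q ` points X. k y \<in> V} (g \<circ> k)"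
      unfolding quotient_fspace_def fspace.simps pre .
    then show "regular ?Q {y \<in> points ?Q. k y \<in> V} (g \<circ> k)"
      by (simp only: points_quotient_fspace)
  qed
  moreover have "k ((q \<circ> s) y) = y" if "y \<in> points Y" for y
    using that by (simp add: kq sX \<kappa>s)
  moreover have "(q \<circ> s) (k y) = y" if "y \<in> points ?Q" for y
    using that by (auto simp: points_quotient_fspace kq s\<kappa>)
  ultimately show ?thesis
    unfolding isomorphic_varieties_def by blast
qed

section \<open>Points of projective space\<close>

lemma proj_point_cscale: "c \<noteq> 0 \<Longrightarrow> proj_point (cscale c x) = proj_point x"
proof -
  assume c: "c \<noteq> 0"
  have "cscale d (cscale c x) \<in> proj_point x" if "d \<noteq> 0" for d
    unfolding proj_point_def using that c by (auto intro!: exI[of _ "d * c"] simp: cscale_def)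
  moreover have "cscale d x \<in> proj_point (cscale c x)" if "d \<noteq> 0" for d
    unfolding proj_point_def using that c by (auto intro!: exI[of _ "d / c"] simp: cscale_def)
  ultimately show ?thesis
    unfolding proj_point_def[of x] proj_point_def[of "cscale c x"] by blast
qed

lemma proj_point_self: "x \<in> proj_point x"
  unfolding proj_point_def by (auto intro!: exI[of _ 1] simp: cscale_def)

lemma mem_proj_point: "y \<in> proj_point x \<longleftrightarrow> (\<exists>c. c \<noteq> 0 \<and> y = cscale c x)"
  by (auto simp: proj_point_def)

lemma proj_space_eq_proj_point:
  assumes "P \<in> proj_space I" "u \<in> P"
  shows "P = proj_point u" "u \<in> coord_space I" "u \<noteq> 0"
proof -
  obtain w where w: "P = proj_point w" "w \<in> coord_space I" "w \<noteq> 0"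
    using assms(1) by (auto simp: proj_space_def)
  obtain c where c: "c \<noteq> 0" "u = cscale c w" using assms(2) w by (auto simp: mem_proj_point)
  show "P = proj_point u" using c w by (simp add: proj_point_cscale)
  show "u \<in> coord_space I" using c w by (auto simp: coord_space_def cscale_def)
  show "u \<noteq> 0" using c w by (auto simp: cscale_def fun_eq_iff)
qed

lemma proj_point_P1_eqI:
  assumes "u \<in> coord_space {0, 1::nat}" "v \<in> coord_space {0, 1}"
    and "u 0 \<noteq> 0 \<or> u 1 \<noteq> 0" "v 0 \<noteq> 0 \<or> v 1 \<noteq> 0" "u 0 * v 1 = u 1 * v 0"
  shows "proj_point u = proj_point v"
proof -
  have "\<exists>c. c \<noteq> 0 \<and> u 0 = c * v 0 \<and> u 1 = c * v 1"
  proof (cases "v 0 = 0")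
    case True
    then have "v 1 \<noteq> 0" "u 0 = 0" using assms by auto
    then show ?thesis using assms True by (intro exI[of _ "u 1 / v 1"]) auto
  next
    case False
    then have "u 0 \<noteq> 0" using assms by auto
    then show ?thesis using assms False
      by (intro exI[of _ "u 0 / v 0"]) (auto simp: field_simps)
  qed
  then obtain c where c: "c \<noteq> 0" "u 0 = c * v 0" "u 1 = c * v 1" by blast
  have "u i = c * v i" for i
    using assms(1,2) c by (cases "i \<in> {0, 1}") (auto simp: coord_space_def)
  then have "u = cscale c v" by (auto simp: cscale_def)
  then show ?thesis using c by (simp add: proj_point_cscale)
qed

section \<open>Parke--Taylor vectors\<close>

text \<open>The vector of Parke--Taylor functions of an arbitrary array \<open>p\<close> of numbers in place of the
  Pluecker coordinates.\<close>

definition parke_taylor_vector :: "nat \<Rightarrow> (nat \<Rightarrow> nat \<Rightarrow> complex) \<Rightarrow> (nat \<Rightarrow> nat) \<Rightarrow> complex" where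
  "parke_taylor_vector n p \<sigma> =
     (if \<sigma> \<in> Sigma_perms n then \<Prod>i=1..n. 1 / p (\<sigma> i) (\<sigma> (i mod n + 1)) else 0)"

lemma PT_map_eq: "PT_map n V = proj_point (parke_taylor_vector n (pluecker V))"
  unfolding PT_map_def parke_taylor_def parke_taylor_vector_def ..

lemma bij_betw_cyclic_succ: "bij_betw (\<lambda>i. i mod n + 1) {1..n} {1..n::nat}"
proof (rule bij_betw_byWitness[where f' = "\<lambda>i. if i = 1 then n else i - 1"])
  show "\<forall>i\<in>{1..n}. (if i mod n + 1 = 1 then n else i mod n + 1 - 1) = i"
  proof
    fix i assume "i \<in> {1..n}"
    then show "(if i mod n + 1 = 1 then n else i mod n + 1 - 1) = i"
      by (cases "i = n") auto
  qed
  show "\<forall>i\<in>{1..n}. (if i = 1 then n else i - 1) mod n + 1 = i" by auto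
  show "(\<lambda>i. i mod n + 1) ` {1..n} \<subseteq> {1..n}" by (auto simp: Suc_le_eq)
  show "(\<lambda>i. if i = 1 then n else i - 1) ` {1..n} \<subseteq> {1..n}" by auto
qed

lemma Sigma_perms_bij:
  assumes "\<sigma> \<in> Sigma_perms n"
  shows "bij_betw \<sigma> {1..n} {1..n}" "bij_betw (\<lambda>i. \<sigma> (i mod n + 1)) {1..n} {1..n}"
proof -
  show 1: "bij_betw \<sigma> {1..n} {1..n}"
    using assms by (auto simp: Sigma_perms_def intro: permutes_imp_bij)
  show "bij_betw (\<lambda>i. \<sigma> (i mod n + 1)) {1..n} {1..n}"
    using bij_betw_trans[OF bij_betw_cyclic_succ 1] by (simp add: comp_def)
qed

lemma finite_Sigma_perms: "finite (Sigma_perms n)"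
  by (rule finite_subset[OF _ finite_permutations[of "{1..n}"]]) (auto simp: Sigma_perms_def)

lemma id_in_Sigma_perms: "(\<lambda>i. i) \<in> Sigma_perms n"
  using permutes_id[of "{1..n}"] by (simp add: Sigma_perms_def id_def)

lemma Sigma_perms_succ_neq:
  assumes "\<sigma> \<in> Sigma_perms n" "2 \<le> n" "i \<in> {1..n}"
  shows "\<sigma> i \<in> {1..n}" "\<sigma> (i mod n + 1) \<in> {1..n}" "\<sigma> i \<noteq> \<sigma> (i mod n + 1)"
proof -
  have i: "i mod n + 1 \<in> {1..n}" "i mod n + 1 \<noteq> i"
  proof -
    consider "i = n" | "i < n" using assms(3) by force
    then have "i mod n + 1 \<in> {1..n} \<and> i mod n + 1 \<noteq> i"
      by cases (use assms(2) in simp_all)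
    then show "i mod n + 1 \<in> {1..n}" "i mod n + 1 \<noteq> i" by blast+
  qed
  show "\<sigma> i \<in> {1..n}" "\<sigma> (i mod n + 1) \<in> {1..n}"
    using bij_betwE[OF Sigma_perms_bij(1)[OF assms(1)]] assms(3) i(1) by auto
  show "\<sigma> i \<noteq> \<sigma> (i mod n + 1)"
    using inj_onD[OF bij_betw_imp_inj_on[OF Sigma_perms_bij(1)[OF assms(1)]], of i "i mod n + 1"]
      assms(3) i by metis
qed

lemma parke_taylor_vector_nonzero:
  assumes "\<sigma> \<in> Sigma_perms n" "2 \<le> n"
    and "\<And>i j. i \<in> {1..n} \<Longrightarrow> j \<in> {1..n} \<Longrightarrow> i \<noteq> j \<Longrightarrow> p i j \<noteq> 0"
  shows "parke_taylor_vector n p \<sigma> \<noteq> 0"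
  unfolding parke_taylor_vector_def
  using assms(1) Sigma_perms_succ_neq[OF assms(1,2)] assms(3) by simp

text \<open>A permutation \<open>\<sigma>\<close> visits every index twice in its cyclic list of consecutive pairs. Hence rescaling
  \<open>p i j\<close> by \<open>e * c i * c j\<close> multiplies all Parke--Taylor functions by the same factor. This covers a
  change of basis of the subspace (factor \<open>e\<close>) and a rescaling of the columns (factors \<open>c\<close>).\<close>

lemma parke_taylor_vector_rescale:
  assumes "\<And>i j. i \<in> {1..n} \<Longrightarrow> j \<in> {1..n} \<Longrightarrow> i \<noteq> j \<Longrightarrow> p' i j = e * c i * c j * p i j"
    and n: "2 \<le> n"
  shows "parke_taylor_vector n p' =
     cscale ((1 / e) ^ n * (\<Prod>j=1..n. 1 / c j)\<^sup>2) (parke_taylor_vector n p)"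
proof
  fix \<sigma>
  show "parke_taylor_vector n p' \<sigma> =
     cscale ((1 / e) ^ n * (\<Prod>j=1..n. 1 / c j)\<^sup>2) (parke_taylor_vector n p) \<sigma>"
  proof (cases "\<sigma> \<in> Sigma_perms n")
    case True
    have "(\<Prod>i=1..n. 1 / p' (\<sigma> i) (\<sigma> (i mod n + 1))) =
       (\<Prod>i=1..n. (1 / e) * (1 / c (\<sigma> i)) * (1 / c (\<sigma> (i mod n + 1))) *
          (1 / p (\<sigma> i) (\<sigma> (i mod n + 1))))"
      using Sigma_perms_succ_neq[OF True n] by (intro prod.cong refl) (simp add: assms(1))
    also have "\<dots> = (1 / e) ^ n * (\<Prod>i=1..n. 1 / c (\<sigma> i)) * (\<Prod>i=1..n. 1 / c (\<sigma> (i mod n + 1))) *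
       (\<Prod>i=1..n. 1 / p (\<sigma> i) (\<sigma> (i mod n + 1)))"
      by (simp only: prod.distrib) simp
    also have "(\<Prod>i=1..n. 1 / c (\<sigma> i)) = (\<Prod>j=1..n. 1 / c j)"
      by (rule prod.reindex_bij_betw[OF Sigma_perms_bij(1)[OF True]])
    also have "(\<Prod>i=1..n. 1 / c (\<sigma> (i mod n + 1))) = (\<Prod>j=1..n. 1 / c j)"
      by (rule prod.reindex_bij_betw[OF Sigma_perms_bij(2)[OF True]])
    finally show ?thesis
      using True by (simp only: parke_taylor_vector_def cscale_def if_True power2_eq_square mult.assoc)
  qed (simp add: parke_taylor_vector_def cscale_def)
qed

lemma proj_point_parke_taylor_rescale:
  assumes "\<And>i j. i \<in> {1..n} \<Longrightarrow> j \<in> {1..n} \<Longrightarrow> i \<noteq> j \<Longrightarrow> p' i j = e * c i * c j * p i j"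
    and "2 \<le> n" "e \<noteq> 0" "\<And>j. j \<in> {1..n} \<Longrightarrow> c j \<noteq> 0"
  shows "proj_point (parke_taylor_vector n p') = proj_point (parke_taylor_vector n p)"
  by (subst parke_taylor_vector_rescale[OF assms(1,2)]) (use assms in \<open>simp_all add: proj_point_cscale\<close>)

lemma Sigma_perms_swap:
  assumes "\<sigma> \<in> Sigma_perms n" "3 \<le> m" "m < n"
  shows "\<sigma> \<circ> Transposition.transpose m (m + 1) \<in> Sigma_perms n"
proof -
  have "Transposition.transpose m (m + 1) permutes {1..n}"
    by (rule permutes_swap_id) (use assms in auto)
  then show ?thesis
    using assms by (auto simp: Sigma_perms_def Transposition.transpose_def intro: permutes_compose)
qed

text \<open>Swapping two neighbours \<open>B, C\<close> in the cyclic word \<open>\<dots> A B C E \<dots>\<close> changes three factors of the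
  Parke--Taylor function, and the quotient of the two functions is a cross-ratio of \<open>A, B, C, E\<close> up
  to sign. The index \<open>(m + 1) mod n + 1\<close> is the cyclic successor of \<open>m + 1\<close>.\<close>

lemma parke_taylor_vector_swap:
  fixes p :: "nat \<Rightarrow> nat \<Rightarrow> complex"
  assumes \<sigma>: "\<sigma> \<in> Sigma_perms n" and m: "3 \<le> m" "m < n"
    and nz: "\<And>i j. i \<in> {1..n} \<Longrightarrow> j \<in> {1..n} \<Longrightarrow> i \<noteq> j \<Longrightarrow> p i j \<noteq> 0"
    and skew: "\<And>i j. p j i = - p i j"
    and A: "\<sigma> (m - 1) = A" and B: "\<sigma> m = B" and C: "\<sigma> (m + 1) = C"
    and E: "\<sigma> ((m + 1) mod n + 1) = E"
  shows "parke_taylor_vector n p (\<sigma> \<circ> Transposition.transpose m (m + 1)) * (p A C * p B E) =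
     - (parke_taylor_vector n p \<sigma> * (p A B * p C E))"
proof -
  define \<tau> where "\<tau> = \<sigma> \<circ> Transposition.transpose m (m + 1)"
  define f g where "f i = 1 / p (\<sigma> i) (\<sigma> (i mod n + 1))" and "g i = 1 / p (\<tau> i) (\<tau> (i mod n + 1))" for i
  let ?S = "{m - 1, m, m + 1}"
  have S: "?S \<subseteq> {1..n}" using m by auto
  have t: "(m + 1) mod n + 1 \<noteq> m" "(m + 1) mod n + 1 \<noteq> m + 1" using m by (cases "m + 1 = n"; auto)+
  have \<tau>: "\<tau> (m - 1) = A" "\<tau> m = C" "\<tau> (m + 1) = B" "\<tau> ((m + 1) mod n + 1) = E"
    using A B C E m t by (auto simp: \<tau>_def Transposition.transpose_def)
  have suc: "(m - 1) mod n + 1 = m" "m mod n + 1 = m + 1" using m by auto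
  have prod_S: "(\<Prod>i\<in>?S. h i) = h (m - 1) * h m * h (m + 1)" for h :: "nat \<Rightarrow> complex"
  proof -
    have "m - 1 \<noteq> m" "m - 1 \<noteq> m + 1" "m \<noteq> m + 1" using m by auto
    then show ?thesis by (simp add: mult.assoc del: One_nat_def add_Suc_right)
  qed
  have gS: "(\<Prod>i\<in>?S. g i) = 1 / (p A C * p C B * p B E)"
    unfolding prod_S g_def suc \<tau> by simp
  have fS: "(\<Prod>i\<in>?S. f i) = 1 / (p A B * p B C * p C E)"
    unfolding prod_S f_def suc A B C E by simp
  have rest: "(\<Prod>i\<in>{1..n} - ?S. g i) = (\<Prod>i\<in>{1..n} - ?S. f i)"
  proof (intro prod.cong refl)
    fix i assume i: "i \<in> {1..n} - ?S"
    have "i mod n + 1 \<noteq> m" "i mod n + 1 \<noteq> m + 1"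
      using i m by (cases "i = n"; auto)+
    then have "\<tau> i = \<sigma> i" "\<tau> (i mod n + 1) = \<sigma> (i mod n + 1)"
      using i by (auto simp: \<tau>_def Transposition.transpose_def)
    then show "g i = f i" by (simp add: f_def g_def)
  qed
  have pf: "parke_taylor_vector n p \<sigma> = (\<Prod>i\<in>{1..n} - ?S. f i) * (1 / (p A B * p B C * p C E))"
    using \<sigma> prod.subset_diff[OF S finite_atLeastAtMost, of f]
    unfolding fS by (simp only: parke_taylor_vector_def f_def[symmetric] if_True finite_atLeastAtMost simp_thms)
  have pg: "parke_taylor_vector n p \<tau> = (\<Prod>i\<in>{1..n} - ?S. f i) * (1 / (p A C * p C B * p B E))"
    using Sigma_perms_swap[OF \<sigma> m] prod.subset_diff[OF S finite_atLeastAtMost, of g]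
    unfolding gS rest \<tau>_def[symmetric]
    by (simp only: parke_taylor_vector_def g_def[symmetric] if_True finite_atLeastAtMost simp_thms)
  have inj: "inj_on \<sigma> {1..n}" using Sigma_perms_bij(1)[OF \<sigma>] by (simp add: bij_betw_def)
  have ran: "\<sigma> i \<in> {1..n}" if "i \<in> {1..n}" for i
    using bij_betwE[OF Sigma_perms_bij(1)[OF \<sigma>]] that by blast
  have tt: "(m + 1) mod n + 1 \<in> {1..n}" "(m + 1) mod n + 1 \<noteq> m - 1"
    using m by (auto simp: Suc_le_eq) (cases "m + 1 = n"; auto)
  have mem: "A \<in> {1..n}" "B \<in> {1..n}" "C \<in> {1..n}" "E \<in> {1..n}"
    unfolding A[symmetric] B[symmetric] C[symmetric] E[symmetric]
    by (rule ran; use m tt in auto)+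
  have neq: "\<sigma> i \<noteq> \<sigma> k" if "i \<in> {1..n}" "k \<in> {1..n}" "i \<noteq> k" for i k
    using inj_onD[OF inj] that by blast
  have ne: "A \<noteq> B" "A \<noteq> C" "B \<noteq> C" "B \<noteq> E" "C \<noteq> E"
    unfolding A[symmetric] B[symmetric] C[symmetric] E[symmetric]
    by (rule neq; use m t tt in auto)+
  have "p A B \<noteq> 0" "p A C \<noteq> 0" "p B C \<noteq> 0" "p B E \<noteq> 0" "p C E \<noteq> 0"
    using nz mem ne by auto
  then show ?thesis
    unfolding \<tau>_def[symmetric] pf pg using skew[of B C] by (simp add: field_simps)
qed

lemma inj_on_id_upd3:
  assumes "distinct [a, b, u, v, w]" "distinct [a, b, x, y, z]"
  shows "inj_on (id(u := x, v := y, w := z)) {a, b, u, v, w}"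
  using assms by (auto simp: inj_on_def)

lemma image_id_upd3:
  assumes "distinct [a, b, u, v, w]"
  shows "id(u := x, v := y, w := z) ` {a, b, u, v, w} = {a, b, x, y, z}"
  using assms by auto

lemma ex_permutation_extending:
  assumes "finite S" "T \<subseteq> S" "inj_on f T" "f ` T \<subseteq> S"
  shows "\<exists>\<sigma>. \<sigma> permutes S \<and> (\<forall>t\<in>T. \<sigma> t = f t)"
proof -
  have "card (S - T) = card (S - f ` T)"
    using assms by (simp add: card_Diff_subset finite_subset card_image)
  then obtain g where g: "bij_betw g (S - T) (S - f ` T)"
    using assms(1) finite_same_card_bij[of "S - T" "S - f ` T"] by auto
  define \<sigma> where "\<sigma> t = (if t \<in> T then f t else if t \<in> S then g t else t)" for t
  have "bij_betw \<sigma> T (f ` T)"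
    using assms(3) by (auto simp: bij_betw_def inj_on_def \<sigma>_def)
  moreover have "bij_betw \<sigma> (S - T) (S - f ` T)"
    using g by (subst bij_betw_cong[of _ _ g]) (auto simp: \<sigma>_def)
  ultimately have "bij_betw \<sigma> (T \<union> (S - T)) (f ` T \<union> (S - f ` T))"
    by (intro bij_betw_combine) auto
  moreover have "T \<union> (S - T) = S" "f ` T \<union> (S - f ` T) = S" using assms by auto
  ultimately have "\<sigma> permutes S"
    using assms(2) by (intro bij_imp_permutes) (auto simp: \<sigma>_def)
  then show ?thesis by (intro exI[of _ \<sigma>]) (simp add: \<sigma>_def)
qed

text \<open>The moduli are recovered from the Parke--Taylor vector: the transformation moving the points
  \<open>1, 2, 3\<close> to \<open>[1 : 0], [0 : 1], [1 : 1]\<close> moves the point \<open>j\<close> to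
  \<open>[p 2 j * p 3 1 : p 2 3 * p j 1]\<close>, and this is \<open>[N : M]\<close> for homogeneous polynomials \<open>N, M\<close> of
  the same degree in the Parke--Taylor functions. For \<open>j \<ge> 4\<close> and \<open>n = 4\<close> a single swap of
  neighbours gives the cross-ratio of \<open>1, 2, 3, j\<close>. For \<open>n \<ge> 5\<close> it is the product of the
  cross-ratios of \<open>2, 3, j, k\<close> and \<open>k, 3, j, 1\<close> with an auxiliary index \<open>k\<close>, which come from the
  words \<open>1 2 3 j k \<dots>\<close> and \<open>1 2 \<dots> k 3 j\<close>.\<close>

lemma parke_taylor_normal_form:
  assumes n: "4 \<le> n" and j: "j \<in> {1..n}"
  shows "\<exists>d N M. mhom_fun (Sigma_perms n) (\<lambda>_. ()) d N \<and> mhom_fun (Sigma_perms n) (\<lambda>_. ()) d M \<and>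
     (\<forall>p. (\<forall>i k. p k i = - p i k) \<and> (\<forall>i\<in>{1..n}. \<forall>k\<in>{1..n}. i \<noteq> k \<longrightarrow> p i k \<noteq> 0) \<longrightarrow>
        (N (parke_taylor_vector n p) \<noteq> 0 \<or> M (parke_taylor_vector n p) \<noteq> 0) \<and>
        N (parke_taylor_vector n p) * (p 2 3 * p j 1) = M (parke_taylor_vector n p) * (p 2 j * p 3 1))"
proof -
  let ?hom = "mhom_fun (Sigma_perms n) (\<lambda>_. ())"
  have c: "?hom (\<lambda>_. 0) (\<lambda>z. a)" for a by (rule mhom_fun_const)
  consider "j = 1" | "j = 2" | "j = 3" | "4 \<le> j" "n = 4" | "4 \<le> j" "5 \<le> n"
    using j n by force
  then show ?thesis
  proof cases
    case 1
    show ?thesis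
    proof (intro exI conjI allI impI)
      show "?hom (\<lambda>_. 0) (\<lambda>z. 1)" "?hom (\<lambda>_. 0) (\<lambda>z. 0)" by (rule c)+
      fix p :: "nat \<Rightarrow> nat \<Rightarrow> complex"
      assume "(\<forall>i k. p k i = - p i k) \<and> (\<forall>i\<in>{1..n}. \<forall>k\<in>{1..n}. i \<noteq> k \<longrightarrow> p i k \<noteq> 0)"
      then have "p 1 1 = - p 1 1" by blast
      then show "1 * (p 2 3 * p j 1) = 0 * (p 2 j * p 3 1)" unfolding 1 by simp
    qed simp
  next
    case 2
    show ?thesis
    proof (intro exI conjI allI impI)
      show "?hom (\<lambda>_. 0) (\<lambda>z. 0)" "?hom (\<lambda>_. 0) (\<lambda>z. 1)" by (rule c)+
      fix p :: "nat \<Rightarrow> nat \<Rightarrow> complex"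
      assume "(\<forall>i k. p k i = - p i k) \<and> (\<forall>i\<in>{1..n}. \<forall>k\<in>{1..n}. i \<noteq> k \<longrightarrow> p i k \<noteq> 0)"
      then have "p 2 2 = - p 2 2" by blast
      then show "0 * (p 2 3 * p j 1) = 1 * (p 2 j * p 3 1)" unfolding 2 by simp
    qed simp
  next
    case 3
    show ?thesis
    proof (intro exI conjI allI impI)
      show "?hom (\<lambda>_. 0) (\<lambda>z. 1)" "?hom (\<lambda>_. 0) (\<lambda>z. 1)" by (rule c)+
      show "1 * (p 2 3 * p j 1) = 1 * (p 2 j * p 3 1)" for p :: "nat \<Rightarrow> nat \<Rightarrow> complex"
        unfolding 3 by simp
    qed simp
  next
    case 4
    then have j4: "j = 4" using j by simp
    define \<sigma> where "\<sigma> = (\<lambda>i::nat. i)"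
    define \<sigma>' where "\<sigma>' = \<sigma> \<circ> Transposition.transpose 3 (3 + 1)"
    have \<sigma>: "\<sigma> \<in> Sigma_perms n" unfolding \<sigma>_def by (rule id_in_Sigma_perms)
    have \<sigma>': "\<sigma>' \<in> Sigma_perms n" unfolding \<sigma>'_def by (rule Sigma_perms_swap) (use \<sigma> 4 in auto)
    show ?thesis
    proof (intro exI conjI allI impI)
      show "?hom (\<lambda>l. if l = () then 1 else 0) (\<lambda>z. - 1 * z \<sigma>)"
        by (intro mhom_fun_cmult mhom_fun_var \<sigma>)
      show "?hom (\<lambda>l. if l = () then 1 else 0) (\<lambda>z. z \<sigma>')"
        by (intro mhom_fun_var \<sigma>')
      fix p :: "nat \<Rightarrow> nat \<Rightarrow> complex"
      assume p: "(\<forall>i k. p k i = - p i k) \<and> (\<forall>i\<in>{1..n}. \<forall>k\<in>{1..n}. i \<noteq> k \<longrightarrow> p i k \<noteq> 0)"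
      have skew: "\<And>i k. p k i = - p i k"
        and nz: "\<And>i k. i \<in> {1..n} \<Longrightarrow> k \<in> {1..n} \<Longrightarrow> i \<noteq> k \<Longrightarrow> p i k \<noteq> 0"
        using p by blast+
      show "- 1 * parke_taylor_vector n p \<sigma> \<noteq> 0 \<or> parke_taylor_vector n p \<sigma>' \<noteq> 0"
        using parke_taylor_vector_nonzero[OF \<sigma>' _ nz] n by simp
      have "parke_taylor_vector n p (\<sigma> \<circ> Transposition.transpose 3 (3 + 1)) * (p 2 4 * p 3 1) =
          - (parke_taylor_vector n p \<sigma> * (p 2 3 * p 4 1))"
        by (rule parke_taylor_vector_swap[OF \<sigma> _ _ nz skew]) (use 4 in \<open>auto simp: \<sigma>_def\<close>)
      then show "- 1 * parke_taylor_vector n p \<sigma> * (p 2 3 * p j 1) =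
          parke_taylor_vector n p \<sigma>' * (p 2 j * p 3 1)"
        by (simp add: \<sigma>'_def j4)
    qed
  next
    case 5
    define k :: nat where "k = (if j = 4 then 5 else 4)"
    have k: "k \<in> {1..n}" "4 \<le> k" "k \<noteq> j" using 5 by (simp_all add: k_def)
    \<comment> \<open>\<open>\<sigma>\<close> is the word \<open>1 2 3 j k \<dots>\<close> and \<open>\<tau>\<close> is the word \<open>1 2 \<dots> k 3 j\<close>; for \<open>n = 5\<close> the positions
      \<open>n - 2\<close> and \<open>3\<close> coincide.\<close>
    obtain \<sigma> where \<sigma>p: "\<sigma> permutes {1..n}" and \<sigma>v: "\<forall>t\<in>{1,2,3,4,5}. \<sigma> t = (id(4 := j, 5 := k)) t"
      using ex_permutation_extending[of "{1..n}" "{1,2,3,4,5}" "id(4 := j, 5 := k)"] 5 j k by auto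
    have sub: "{1, 2, n - 2, n - 1, n} \<subseteq> {1..n}" using 5 by auto
    have inj: "inj_on (id(n - 2 := k, n - 1 := 3, n := j)) {1, 2, n - 2, n - 1, n}"
      by (rule inj_on_id_upd3) (use 5 k in auto)
    have img: "id(n - 2 := k, n - 1 := 3, n := j) ` {1, 2, n - 2, n - 1, n} \<subseteq> {1..n}"
      by (subst image_id_upd3) (use 5 k j in auto)
    obtain \<tau> where \<tau>p: "\<tau> permutes {1..n}"
      and \<tau>: "\<forall>t\<in>{1, 2, n - 2, n - 1, n}. \<tau> t = (id(n - 2 := k, n - 1 := 3, n := j)) t"
      using ex_permutation_extending[OF finite_atLeastAtMost sub inj img] by (elim exE conjE)
    have \<tau>v: "\<tau> 1 = 1" "\<tau> 2 = 2" "\<tau> (n - 2) = k" "\<tau> (n - 1) = 3" "\<tau> n = j"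
    proof -
      have ne: "1 \<noteq> n - 2" "1 \<noteq> n - 1" "1 \<noteq> n" "2 \<noteq> n - 2" "2 \<noteq> n - 1" "2 \<noteq> n"
        "n - 2 \<noteq> n - 1" "n - 2 \<noteq> n" "n - 1 \<noteq> n" using 5 by arith+
      show "\<tau> 1 = 1" "\<tau> 2 = 2" "\<tau> (n - 2) = k" "\<tau> (n - 1) = 3" "\<tau> n = j"
        using ne by (simp_all add: \<tau>[rule_format])
    qed
    have \<sigma>: "\<sigma> \<in> Sigma_perms n"
      using \<sigma>p \<sigma>v by (simp add: Sigma_perms_def)
    have \<tau>: "\<tau> \<in> Sigma_perms n"
      using \<tau>p \<tau>v(1,2) by (simp add: Sigma_perms_def)
    define \<sigma>' where "\<sigma>' = \<sigma> \<circ> Transposition.transpose 3 (3 + 1)"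
    define \<tau>' where "\<tau>' = \<tau> \<circ> Transposition.transpose (n - 1) (n - 1 + 1)"
    have \<sigma>': "\<sigma>' \<in> Sigma_perms n" unfolding \<sigma>'_def by (rule Sigma_perms_swap) (use \<sigma> 5 in auto)
    have \<tau>': "\<tau>' \<in> Sigma_perms n" unfolding \<tau>'_def by (rule Sigma_perms_swap) (use \<tau> 5 in auto)
    show ?thesis
    proof (intro exI conjI allI impI)
      show "?hom (\<lambda>l. (if l = () then 1 else 0) + (if l = () then 1 else 0)) (\<lambda>z. z \<sigma> * z \<tau>)"
        by (intro mhom_fun_mult mhom_fun_var \<sigma> \<tau>)
      show "?hom (\<lambda>l. (if l = () then 1 else 0) + (if l = () then 1 else 0)) (\<lambda>z. z \<sigma>' * z \<tau>')"
        by (intro mhom_fun_mult mhom_fun_var \<sigma>' \<tau>')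
      fix p :: "nat \<Rightarrow> nat \<Rightarrow> complex"
      assume p: "(\<forall>i k. p k i = - p i k) \<and> (\<forall>i\<in>{1..n}. \<forall>k\<in>{1..n}. i \<noteq> k \<longrightarrow> p i k \<noteq> 0)"
      have skew: "\<And>i k. p k i = - p i k"
        and nz: "\<And>i k. i \<in> {1..n} \<Longrightarrow> k \<in> {1..n} \<Longrightarrow> i \<noteq> k \<Longrightarrow> p i k \<noteq> 0"
        using p by blast+
      let ?z = "parke_taylor_vector n p"
      show "?z \<sigma> * ?z \<tau> \<noteq> 0 \<or> ?z \<sigma>' * ?z \<tau>' \<noteq> 0"
        using parke_taylor_vector_nonzero[OF \<sigma>' _ nz] parke_taylor_vector_nonzero[OF \<tau>' _ nz] n
        by simp
      have 1: "?z \<sigma>' * (p 2 j * p 3 k) = - (?z \<sigma> * (p 2 3 * p j k))"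
        unfolding \<sigma>'_def
        by (rule parke_taylor_vector_swap[OF \<sigma> _ _ nz skew]) (use 5 \<sigma>v in auto)
      have 2: "?z \<tau>' * (p k j * p 3 1) = - (?z \<tau> * (p k 3 * p j 1))"
        unfolding \<tau>'_def
        by (rule parke_taylor_vector_swap[OF \<tau> _ _ nz skew]) (use 5 \<tau>v in \<open>simp_all add: numeral_2_eq_2\<close>)
      have sk: "p k 3 = - p 3 k" "p k j = - p j k" using skew by blast+
      have nz': "p 3 k \<noteq> 0" "p j k \<noteq> 0" using nz[of 3 k] nz[of j k] k j 5 by simp_all
      have "(?z \<sigma>' * (p 2 j * p 3 k)) * (?z \<tau>' * (p k j * p 3 1)) =
          (?z \<sigma> * (p 2 3 * p j k)) * (?z \<tau> * (p k 3 * p j 1))"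
        unfolding 1 2 by simp
      then have "(p 3 k * p j k) * (?z \<sigma> * ?z \<tau> * (p 2 3 * p j 1)) =
          (p 3 k * p j k) * (?z \<sigma>' * ?z \<tau>' * (p 2 j * p 3 1))"
        unfolding sk by (auto simp: mult_ac)
      then show "?z \<sigma> * ?z \<tau> * (p 2 3 * p j 1) = ?z \<sigma>' * ?z \<tau>' * (p 2 j * p 3 1)"
        using nz' by simp
    qed
  qed
qed

section \<open>Configurations of points and their Parke--Taylor points\<close>

text \<open>The Pluecker coordinates of the two-row matrix whose column \<open>j\<close> consists of the homogeneous
  coordinates \<open>x (j, 0), x (j, 1)\<close> of the \<open>j\<close>-th point.\<close>

definition bracket :: "(nat \<times> nat \<Rightarrow> complex) \<Rightarrow> nat \<Rightarrow> nat \<Rightarrow> complex" where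
  "bracket x i j = x (i, 0) * x (j, 1) - x (j, 0) * x (i, 1)"

lemma bracket_skew: "bracket x j i = - bracket x i j"
  by (simp add: bracket_def)

text \<open>The points of the configuration space, and the systems of homogeneous coordinates of one of them.\<close>

definition config_points :: "nat \<Rightarrow> (nat \<Rightarrow> (nat \<Rightarrow> complex) set) set" where
  "config_points n = {a \<in> {1..n} \<rightarrow>\<^sub>E P1. inj_on a {1..n}}"

definition config_coords :: "nat \<Rightarrow> (nat \<Rightarrow> (nat \<Rightarrow> complex) set) \<Rightarrow> (nat \<times> nat \<Rightarrow> complex) set" where
  "config_coords n a =
     {x \<in> coord_space ({1..n} \<times> {0, 1}). \<forall>j\<in>{1..n}. (\<lambda>k. x (j, k)) \<in> a j}"

lemma config_space_eq:
  "config_space n = induced_variety ({1..n} \<times> {0, 1}) fst (config_coords n) (config_points n)"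
  unfolding config_space_def config_coords_def[abs_def] config_points_def ..

lemma config_pointsD:
  assumes "a \<in> config_points n" "x \<in> config_coords n a" "j \<in> {1..n}"
  shows "a j = proj_point (\<lambda>k. x (j, k))" "(\<lambda>k. x (j, k)) \<in> coord_space {0, 1}"
    "x (j, 0) \<noteq> 0 \<or> x (j, 1) \<noteq> 0"
proof -
  have P: "a j \<in> P1" "(\<lambda>k. x (j, k)) \<in> a j"
    using assms by (auto simp: config_points_def config_coords_def PiE_iff)
  note * = proj_space_eq_proj_point[OF P]
  show "a j = proj_point (\<lambda>k. x (j, k))" by (rule *(1))
  show c: "(\<lambda>k. x (j, k)) \<in> coord_space {0, 1}" by (rule *(2))
  show "x (j, 0) \<noteq> 0 \<or> x (j, 1) \<noteq> 0"
  proof (rule ccontr)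
    assume "\<not> ?thesis"
    then have "x (j, k) = 0" for k using c by (cases "k \<in> {0, 1}") (auto simp: coord_space_def)
    then show False using *(3) by (auto simp: fun_eq_iff)
  qed
qed

lemma config_coords_nonempty:
  assumes "a \<in> config_points n"
  shows "config_coords n a \<noteq> {}"
proof -
  have "\<exists>w. w \<in> a j \<and> w \<in> coord_space {0, 1}" if "j \<in> {1..n}" for j
  proof -
    have "a j \<in> P1" using assms that by (auto simp: config_points_def PiE_iff)
    then obtain w where "w \<in> coord_space {0, 1}" "a j = proj_point w" by (auto simp: proj_space_def)
    then show ?thesis using proj_point_self by blast
  qed
  then obtain w where w: "\<And>j. j \<in> {1..n} \<Longrightarrow> w j \<in> a j \<and> w j \<in> coord_space {0, 1}" by metis
  have "(\<lambda>(j, k). if j \<in> {1..n} then w j k else 0) \<in> config_coords n a"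
    using w by (auto simp: config_coords_def coord_space_def)
  then show ?thesis by blast
qed

lemma config_coords_rescale:
  assumes "a \<in> config_points n" "x \<in> config_coords n a" "y \<in> config_coords n a"
  shows "\<exists>c. (\<forall>j. c j \<noteq> 0) \<and> (\<forall>i\<in>{1..n} \<times> {0, 1}. y i = c (fst i) * x i)"
proof -
  have "\<exists>c. c \<noteq> 0 \<and> (\<forall>k. y (j, k) = c * x (j, k))" if "j \<in> {1..n}" for j
  proof -
    have "(\<lambda>k. y (j, k)) \<in> proj_point (\<lambda>k. x (j, k))"
      unfolding config_pointsD(1)[OF assms(1,2) that, symmetric]
      using assms(3) that unfolding config_coords_def by blast
    then show ?thesis by (auto simp: mem_proj_point cscale_def fun_eq_iff)
  qed
  then obtain c where c: "\<And>j. j \<in> {1..n} \<Longrightarrow> c j \<noteq> 0 \<and> (\<forall>k. y (j, k) = c j * x (j, k))" by metis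
  then show ?thesis by (intro exI[of _ "\<lambda>j. if j \<in> {1..n} then c j else 1"]) auto
qed

lemma bracket_nonzero:
  assumes "a \<in> config_points n" "x \<in> config_coords n a" "i \<in> {1..n}" "j \<in> {1..n}" "i \<noteq> j"
  shows "bracket x i j \<noteq> 0"
proof
  assume 0: "bracket x i j = 0"
  note i = config_pointsD[OF assms(1,2,3)] and j = config_pointsD[OF assms(1,2,4)]
  have "a i = a j" unfolding i(1) j(1)
    by (rule proj_point_P1_eqI[OF i(2) j(2) i(3) j(3)]) (use 0 in \<open>simp add: bracket_def mult.commute\<close>)
  moreover have "inj_on a {1..n}" using assms(1) by (simp add: config_points_def)
  ultimately show False using inj_onD assms(3-5) by metis
qed

lemma config_pointsI:
  assumes x: "x \<in> coord_space ({1..n} \<times> {0, 1})" and n: "2 \<le> n"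
    and nz: "\<And>i j. i \<in> {1..n} \<Longrightarrow> j \<in> {1..n} \<Longrightarrow> i \<noteq> j \<Longrightarrow> bracket x i j \<noteq> 0"
    and a: "a = (\<lambda>j\<in>{1..n}. proj_point (\<lambda>k. x (j, k)))"
  shows "a \<in> config_points n" "x \<in> config_coords n a"
proof -
  show "x \<in> config_coords n a" using x proj_point_self by (auto simp: config_coords_def a)
  have "a j \<in> P1" if j: "j \<in> {1..n}" for j
  proof -
    define i :: nat where "i = (if j = 1 then 2 else 1)"
    have "i \<in> {1..n}" "i \<noteq> j" using n by (auto simp: i_def)
    then have "bracket x i j \<noteq> 0" by (rule nz[OF _ j])
    moreover have "bracket x i j = 0" if "(\<lambda>k. x (j, k)) = 0"
      using fun_cong[OF that, of 0] fun_cong[OF that, of 1] by (simp add: bracket_def)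
    ultimately have "(\<lambda>k. x (j, k)) \<noteq> 0" by blast
    moreover have "(\<lambda>k. x (j, k)) \<in> coord_space {0, 1}" using x by (auto simp: coord_space_def)
    ultimately show ?thesis using j by (simp add: a proj_space_def)
  qed
  moreover have "inj_on a {1..n}"
  proof (rule inj_onI, rule ccontr)
    fix i j assume ij: "i \<in> {1..n}" "j \<in> {1..n}" "a i = a j" "i \<noteq> j"
    then have "(\<lambda>k. x (i, k)) \<in> proj_point (\<lambda>k. x (j, k))"
      using proj_point_self[of "\<lambda>k. x (i, k)"] by (simp add: a)
    then obtain c where "\<And>k. x (i, k) = c * x (j, k)"
      by (auto simp: mem_proj_point cscale_def fun_eq_iff)
    then show False using nz[OF ij(1,2,4)] by (simp add: bracket_def)
  qed
  ultimately show "a \<in> config_points n" by (simp add: config_points_def a PiE_iff)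
qed

text \<open>The columns of a matrix representative of a subspace with nonvanishing Pluecker coordinates form a
  configuration of distinct points, and every configuration arises in this way.\<close>

lemma PT_map_image_eq:
  assumes n: "2 \<le> n"
  shows "PT_map n ` Gr2_open n = {proj_point (parke_taylor_vector n (bracket x)) | x a.
     a \<in> config_points n \<and> x \<in> config_coords n a}"
proof (intro equalityI subsetI)
  fix P assume "P \<in> PT_map n ` Gr2_open n"
  then obtain V where V: "V \<in> Gr2 n" and P: "P = PT_map n V"
    and nz: "\<And>i j. i \<in> {1..n} \<Longrightarrow> j \<in> {1..n} \<Longrightarrow> i \<noteq> j \<Longrightarrow> pluecker V i j \<noteq> 0"
    by (auto simp: Gr2_open_def)
  have sV: "cvec.subspace V" "V \<subseteq> coord_space {1..n}" "cvec.dim V = 2" using V by (auto simp: Gr2_def)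
  obtain B where B: "B \<subseteq> V" "V \<subseteq> cvec.span B" "card B = 2"
    using cvec.basis_exists[of V] sV(3) by metis
  obtain u v where uv: "B = {u, v}" using B(3) by (auto simp: card_2_iff)
  have "cvec.span {u, v} = V" using B sV(1) uv cvec.span_minimal by blast
  then obtain c where c: "c \<noteq> 0" "\<And>i j. minor2 u v i j = c * pluecker V i j"
    using pluecker_unique by blast
  have uv0: "u j = 0" "v j = 0" if "j \<notin> {1..n}" for j
    using B(1) uv sV(2) that by (auto simp: coord_space_def)
  define x where "x = (\<lambda>(j, k). if k = (0::nat) then u j else if k = 1 then v j else 0)"
  have br: "bracket x i j = c * pluecker V i j" for i j
    using c(2)[of i j] by (simp add: bracket_def x_def minor2_def)
  define a where "a = (\<lambda>j\<in>{1..n}. proj_point (\<lambda>k. x (j, k)))"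
  have "x \<in> coord_space ({1..n} \<times> {0, 1})"
    using uv0 by (auto simp: coord_space_def x_def)
  then have "a \<in> config_points n" "x \<in> config_coords n a"
    using config_pointsI[OF _ n _ a_def] br c(1) nz by auto
  moreover have "P = proj_point (parke_taylor_vector n (bracket x))"
    unfolding P PT_map_eq
    by (rule proj_point_parke_taylor_rescale[symmetric, where e = c and c = "\<lambda>_. 1"])
      (use br c(1) n in auto)
  ultimately show "P \<in> {proj_point (parke_taylor_vector n (bracket x)) | x a.
     a \<in> config_points n \<and> x \<in> config_coords n a}" by blast
next
  fix P assume "P \<in> {proj_point (parke_taylor_vector n (bracket x)) | x a.
     a \<in> config_points n \<and> x \<in> config_coords n a}"
  then obtain x a where a: "a \<in> config_points n" and x: "x \<in> config_coords n a"
    and P: "P = proj_point (parke_taylor_vector n (bracket x))" by blast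
  define u v where "u j = x (j, 0)" and "v j = x (j, 1)" for j
  have br: "minor2 u v i j = bracket x i j" for i j
    by (simp add: bracket_def minor2_def u_def v_def)
  have nz: "bracket x i j \<noteq> 0" if "i \<in> {1..n}" "j \<in> {1..n}" "i \<noteq> j" for i j
    using bracket_nonzero[OF a x] that by blast
  have m12: "minor2 u v 1 2 \<noteq> 0" unfolding br using nz[of 1 2] n by simp
  define V where "V = cvec.span {u, v}"
  obtain c where c: "c \<noteq> 0" "\<And>i j. minor2 u v i j = c * pluecker V i j"
    using pluecker_unique[OF V_def[symmetric]] by blast
  have v0: "v \<noteq> 0" using m12 by (auto simp: minor2_def)
  have nspan: "u \<notin> cvec.span {v}"
  proof
    assume "u \<in> cvec.span {v}"
    then obtain t where "u = cscale t v" by (auto simp: cvec.span_singleton)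
    then show False using m12 by (simp add: minor2_def cscale_def)
  qed
  have ind: "cvec.independent {u, v}"
    by (rule cvec.independent_insertI[OF nspan]) (use v0 in \<open>simp add: cvec.dependent_single\<close>)
  have "u \<noteq> v" using nspan cvec.span_base[of v "{v}"] by blast
  then have "cvec.dim V = 2"
    unfolding V_def using cvec.dim_span_eq_card_independent[OF ind] by simp
  moreover have "V \<subseteq> coord_space {1..n}"
    unfolding V_def
  proof (rule cvec.span_minimal)
    show "{u, v} \<subseteq> coord_space {1..n}"
      using x by (auto simp: config_coords_def coord_space_def u_def v_def)
    show "cvec.subspace (coord_space {1..n})"
      by (auto simp: cvec.subspace_def coord_space_def cscale_def)
  qed
  moreover have "cvec.subspace V" unfolding V_def by (rule cvec.subspace_span)
  moreover have "pluecker V i j \<noteq> 0" if "i \<in> {1..n}" "j \<in> {1..n}" "i \<noteq> j" for i j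
    using nz[OF that] c(2)[of i j] br by auto
  ultimately have "V \<in> Gr2_open n" by (simp add: Gr2_open_def Gr2_def)
  moreover have "P = PT_map n V"
    unfolding P PT_map_eq
    by (rule proj_point_parke_taylor_rescale[where e = c and c = "\<lambda>_. 1"])
      (use br c n in auto)
  ultimately show "P \<in> PT_map n ` Gr2_open n" by blast
qed

text \<open>The Parke--Taylor point of a configuration. By the next lemma it does not depend on the chosen
  homogeneous coordinates.\<close>

definition pt_of_config :: "nat \<Rightarrow> (nat \<Rightarrow> (nat \<Rightarrow> complex) set) \<Rightarrow> ((nat \<Rightarrow> nat) \<Rightarrow> complex) set" where
  "pt_of_config n a =
     proj_point (parke_taylor_vector n (bracket (SOME x. x \<in> config_coords n a)))"

lemma pt_of_config_eq:
  assumes "2 \<le> n" "a \<in> config_points n" "x \<in> config_coords n a"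
  shows "pt_of_config n a = proj_point (parke_taylor_vector n (bracket x))"
proof -
  define y where "y = (SOME x. x \<in> config_coords n a)"
  have "y \<in> config_coords n a" unfolding y_def by (rule someI[of "\<lambda>x. x \<in> config_coords n a"]) (rule assms(3))
  then obtain c where c: "\<And>j. c j \<noteq> 0" "\<And>i. i \<in> {1..n} \<times> {0, 1} \<Longrightarrow> y i = c (fst i) * x i"
    using config_coords_rescale[OF assms(2,3)] by blast
  show ?thesis
    unfolding pt_of_config_def y_def[symmetric]
    by (rule proj_point_parke_taylor_rescale[where e = 1 and c = c])
      (use c assms(1) in \<open>auto simp: bracket_def algebra_simps\<close>)
qed

lemma PT_points_eq:
  assumes "2 \<le> n"
  shows "PT_map n ` Gr2_open n = pt_of_config n ` config_points n"
  unfolding PT_map_image_eq[OF assms]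
proof (intro equalityI subsetI)
  fix P assume "P \<in> pt_of_config n ` config_points n"
  then obtain a where a: "a \<in> config_points n" "P = pt_of_config n a" by blast
  then obtain x where "x \<in> config_coords n a" using config_coords_nonempty by blast
  then show "P \<in> {proj_point (parke_taylor_vector n (bracket x)) | x a.
     a \<in> config_points n \<and> x \<in> config_coords n a}"
    using a pt_of_config_eq[OF assms a(1)] by auto
qed (use pt_of_config_eq[OF assms] in force)

text \<open>The Parke--Taylor functions after clearing denominators: the function of \<open>\<sigma>\<close> is multiplied by the
  product of \<open>p i j\<close> over all ordered pairs \<open>i \<noteq> j\<close>, which leaves the product over the pairs that
  are not consecutive in \<open>\<sigma>\<close>.\<close>

definition parke_taylor_poly :: "nat \<Rightarrow> (nat \<times> nat \<Rightarrow> complex) \<Rightarrow> (nat \<Rightarrow> nat) \<Rightarrow> complex" where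
  "parke_taylor_poly n x \<sigma> = (if \<sigma> \<in> Sigma_perms n then
     \<Prod>(i, j)\<in>{(i, j). i \<in> {1..n} \<and> j \<in> {1..n} \<and> i \<noteq> j} - (\<lambda>i. (\<sigma> i, \<sigma> (i mod n + 1))) ` {1..n}.
       bracket x i j else 0)"

lemma cyclic_steps:
  assumes \<sigma>: "\<sigma> \<in> Sigma_perms n" and n: "2 \<le> n"
  shows "inj_on (\<lambda>i. (\<sigma> i, \<sigma> (i mod n + 1))) {1..n}"
    "(\<lambda>i. (\<sigma> i, \<sigma> (i mod n + 1))) ` {1..n} \<subseteq> {(i, j). i \<in> {1..n} \<and> j \<in> {1..n} \<and> i \<noteq> j}"
    "finite {(i, j). i \<in> {1..n} \<and> j \<in> {1..n} \<and> i \<noteq> j}"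
proof -
  show "inj_on (\<lambda>i. (\<sigma> i, \<sigma> (i mod n + 1))) {1..n}"
    by (rule inj_onI, drule arg_cong[of _ _ fst], unfold fst_conv)
      (rule inj_onD[OF bij_betw_imp_inj_on[OF Sigma_perms_bij(1)[OF \<sigma>]]])
  show "(\<lambda>i. (\<sigma> i, \<sigma> (i mod n + 1))) ` {1..n} \<subseteq> {(i, j). i \<in> {1..n} \<and> j \<in> {1..n} \<and> i \<noteq> j}"
    using Sigma_perms_succ_neq[OF \<sigma> n] by blast
  show "finite {(i, j). i \<in> {1..n} \<and> j \<in> {1..n} \<and> i \<noteq> j}"
    by (rule finite_subset[of _ "{1..n} \<times> {1..n}"]) auto
qed

lemma parke_taylor_poly_eq:
  assumes n: "2 \<le> n"
    and nz: "\<And>i j. i \<in> {1..n} \<Longrightarrow> j \<in> {1..n} \<Longrightarrow> i \<noteq> j \<Longrightarrow> bracket x i j \<noteq> 0"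
  shows "parke_taylor_poly n x =
     cscale (\<Prod>(i, j)\<in>{(i, j). i \<in> {1..n} \<and> j \<in> {1..n} \<and> i \<noteq> j}. bracket x i j)
       (parke_taylor_vector n (bracket x))"
proof
  fix \<sigma> :: "nat \<Rightarrow> nat"
  let ?O = "{(i, j). i \<in> {1..n} \<and> j \<in> {1..n} \<and> i \<noteq> j}"
  let ?T = "(\<lambda>i. (\<sigma> i, \<sigma> (i mod n + 1))) ` {1..n}"
  show "parke_taylor_poly n x \<sigma> =
     cscale (\<Prod>(i, j)\<in>?O. bracket x i j) (parke_taylor_vector n (bracket x)) \<sigma>"
  proof (cases "\<sigma> \<in> Sigma_perms n")
    case True
    note st = cyclic_steps[OF True n]
    have "(\<Prod>(i, j)\<in>?T. bracket x i j) = (\<Prod>i=1..n. bracket x (\<sigma> i) (\<sigma> (i mod n + 1)))"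
      by (subst prod.reindex[OF st(1)]) simp
    moreover have "(\<Prod>i=1..n. bracket x (\<sigma> i) (\<sigma> (i mod n + 1))) \<noteq> 0"
      using Sigma_perms_succ_neq[OF True n] nz by simp
    ultimately show ?thesis
      using True prod.subset_diff[OF st(2,3), of "\<lambda>(i, j). bracket x i j"]
      by (simp add: parke_taylor_poly_def parke_taylor_vector_def cscale_def prod_dividef)
  qed (simp add: parke_taylor_poly_def parke_taylor_vector_def cscale_def)
qed

lemma mhom_fun_bracket:
  assumes "i \<in> {1..n}" "j \<in> {1..n}"
  shows "mhom_fun ({1..n} \<times> {0, 1}) fst
     (\<lambda>l. (if l = i then 1 else 0) + (if l = j then 1 else 0)) (\<lambda>x. bracket x i j)"
proof -
  have v: "mhom_fun ({1..n} \<times> {0, 1}) fst (\<lambda>l. if l = i then 1 else 0) (\<lambda>x. x (i, k))"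
    if "i \<in> {1..n}" "k \<in> {0, 1}" for i k :: nat
    using mhom_fun_var[of "(i, k)" "{1..n} \<times> {0, 1}" fst] that by simp
  have "mhom_fun ({1..n} \<times> {0, 1}) fst
     (\<lambda>l. (if l = i then 1 else 0) + (if l = j then 1 else 0)) (\<lambda>x. x (i, k) * x (j, k'))"
    if "k \<in> {0, 1}" "k' \<in> {0, 1}" for k k' :: nat
    using that assms by (intro mhom_fun_mult v)
  moreover have "mhom_fun ({1..n} \<times> {0, 1}) fst
     (\<lambda>l. (if l = i then 1 else 0) + (if l = j then 1 else 0)) (\<lambda>x. x (j, 0::nat) * x (i, 1))"
  proof -
    have "mhom_fun ({1..n} \<times> {0, 1}) fst
       (\<lambda>l. (if l = j then 1 else 0) + (if l = i then 1 else 0)) (\<lambda>x. x (j, 0::nat) * x (i, 1))"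
      using assms by (intro mhom_fun_mult v) auto
    then show ?thesis by (simp add: add.commute)
  qed
  ultimately show ?thesis unfolding bracket_def by (intro mhom_fun_diff) blast+
qed

text \<open>The multidegree does not depend on \<open>\<sigma>\<close>: in each block, the consecutive pairs of \<open>\<sigma>\<close>
  contribute degree two to the product over all pairs. The subtraction of natural numbers below does
  not truncate.\<close>

lemma mhom_fun_parke_taylor_poly:
  assumes \<sigma>: "\<sigma> \<in> Sigma_perms n" and n: "2 \<le> n"
  shows "mhom_fun ({1..n} \<times> {0, 1}) fst
     (\<lambda>l. (\<Sum>(i, j)\<in>{(i, j). i \<in> {1..n} \<and> j \<in> {1..n} \<and> i \<noteq> j}.
        (if l = i then 1 else 0) + (if l = j then 1 else 0)) - (if l \<in> {1..n} then 2 else 0))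
     (\<lambda>x. parke_taylor_poly n x \<sigma>)"
proof -
  let ?O = "{(i, j). i \<in> {1..n} \<and> j \<in> {1..n} \<and> i \<noteq> j}"
  let ?T = "(\<lambda>i. (\<sigma> i, \<sigma> (i mod n + 1))) ` {1..n}"
  let ?w = "\<lambda>l (i, j). (if l = i then 1 else 0) + (if l = j then 1 else 0) :: nat"
  note st = cyclic_steps[OF \<sigma> n]
  have T: "(\<Sum>p\<in>?T. ?w l p) = (if l \<in> {1..n} then 2 else 0)" for l
  proof -
    have "(\<Sum>p\<in>?T. ?w l p) =
        (\<Sum>i=1..n. (if l = \<sigma> i then 1 else 0) + (if l = \<sigma> (i mod n + 1) then 1 else 0))"
      by (subst sum.reindex[OF st(1)]) simp
    also have "\<dots> = (\<Sum>i=1..n. if l = \<sigma> i then 1 else 0) +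
        (\<Sum>i=1..n. if l = \<sigma> (i mod n + 1) then 1 else 0)"
      by (rule sum.distrib)
    also have "(\<Sum>i=1..n. if l = \<sigma> i then 1 else 0) = (\<Sum>j=1..n. if l = j then 1 else (0::nat))"
      by (rule sum.reindex_bij_betw[OF Sigma_perms_bij(1)[OF \<sigma>]])
    also have "(\<Sum>i=1..n. if l = \<sigma> (i mod n + 1) then 1 else 0) = (\<Sum>j=1..n. if l = j then 1 else (0::nat))"
      by (rule sum.reindex_bij_betw[OF Sigma_perms_bij(2)[OF \<sigma>]])
    finally show ?thesis by simp
  qed
  have "mhom_fun ({1..n} \<times> {0, 1}) fst (\<lambda>l. \<Sum>p\<in>?O - ?T. ?w l p)
      (\<lambda>x. \<Prod>p\<in>?O - ?T. (case p of (i, j) \<Rightarrow> bracket x i j))"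
  proof (rule mhom_fun_prod)
    fix p assume "p \<in> ?O - ?T"
    then show "mhom_fun ({1..n} \<times> {0, 1}) fst (\<lambda>l. ?w l p) (\<lambda>x. case p of (i, j) \<Rightarrow> bracket x i j)"
      using mhom_fun_bracket by (cases p) auto
  qed
  moreover have "(\<Sum>p\<in>?O - ?T. ?w l p) = (\<Sum>p\<in>?O. ?w l p) - (if l \<in> {1..n} then 2 else 0)" for l
    using sum.subset_diff[OF st(2,3), of "?w l"] T[of l] by simp
  ultimately show ?thesis
    using \<sigma> by (simp only: parke_taylor_poly_def if_True)
qed

lemma PT_open_eq:
  assumes "2 \<le> n"
  shows "PT_open n =
     induced_variety (Sigma_perms n) (\<lambda>_. ()) (\<lambda>P. P) (pt_of_config n ` config_points n)"
  by (simp add: PT_open_def projective_subvariety_def PT_points_eq[OF assms])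

lemma pt_of_config_morphism:
  assumes n: "2 \<le> n"
  shows "morphism (config_space n) (PT_open n) (pt_of_config n)"
  unfolding config_space_eq PT_open_eq[OF n]
proof (rule morphism_induced_variety[where T = "parke_taylor_poly n" and
    D = "\<lambda>_ l. (\<Sum>(i, j)\<in>{(i, j). i \<in> {1..n} \<and> j \<in> {1..n} \<and> i \<noteq> j}.
        (if l = i then 1 else 0) + (if l = j then 1 else 0)) - (if l \<in> {1..n} then 2 else 0)"])
  show "finite (Sigma_perms n)" by (rule finite_Sigma_perms)
  show "mhom_fun ({1..n} \<times> {0, 1}) fst
     (\<lambda>l. (\<Sum>(i, j)\<in>{(i, j). i \<in> {1..n} \<and> j \<in> {1..n} \<and> i \<noteq> j}.
        (if l = i then 1 else 0) + (if l = j then 1 else 0)) - (if l \<in> {1..n} then 2 else 0))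
     (\<lambda>x. parke_taylor_poly n x \<sigma>)" if "\<sigma> \<in> Sigma_perms n" for \<sigma>
    using mhom_fun_parke_taylor_poly[OF that n] .
  show "parke_taylor_poly n x \<in> pt_of_config n a"
    if a: "a \<in> config_points n" and x: "x \<in> config_coords n a" for a x
  proof -
    have nz: "bracket x i j \<noteq> 0" if "i \<in> {1..n}" "j \<in> {1..n}" "i \<noteq> j" for i j
      using bracket_nonzero[OF a x that] .
    have "(\<Prod>(i, j)\<in>{(i, j). i \<in> {1..n} \<and> j \<in> {1..n} \<and> i \<noteq> j}. bracket x i j) \<noteq> 0"
    proof
      assume "(\<Prod>(i, j)\<in>{(i, j). i \<in> {1..n} \<and> j \<in> {1..n} \<and> i \<noteq> j}. bracket x i j) = 0"
      from iffD1[OF prod_zero_iff[OF cyclic_steps(3)[OF id_in_Sigma_perms n]] this]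
      show False using nz by fast
    qed
    then show ?thesis
      unfolding pt_of_config_eq[OF n a x] mem_proj_point
      by (intro exI conjI) (assumption, rule parke_taylor_poly_eq[OF n nz])
  qed
  show "\<exists>c. (\<forall>j. c j \<noteq> 0) \<and> (\<forall>i\<in>Sigma_perms n. z' i = c () * z i)"
    if Q: "Q \<in> pt_of_config n ` config_points n" and z: "z \<in> Q" "z' \<in> Q" for Q z z'
  proof -
    obtain w where Q: "Q = proj_point w" using Q by (auto simp: pt_of_config_def)
    obtain c c' where "c \<noteq> 0" "c' \<noteq> 0" "z = cscale c w" "z' = cscale c' w"
      using z unfolding Q mem_proj_point by blast
    then show ?thesis by (intro exI[of _ "\<lambda>_. c' / c"]) (simp add: cscale_def)
  qed
qed (use config_coords_nonempty in auto)

section \<open>Projective transformations\<close>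

text \<open>The matrix with rows \<open>(\<alpha>, \<beta>)\<close> and \<open>(\<gamma>, \<delta>)\<close> acting on vectors with coordinates
  indexed by \<open>0, 1\<close>; all other coordinates of the result are zero.\<close>

definition linear_act ::
    "complex \<Rightarrow> complex \<Rightarrow> complex \<Rightarrow> complex \<Rightarrow> (nat \<Rightarrow> complex) \<Rightarrow> nat \<Rightarrow> complex" where
  "linear_act \<alpha> \<beta> \<gamma> \<delta> w k =
     (if k = 0 then \<alpha> * w 0 + \<beta> * w 1 else if k = 1 then \<gamma> * w 0 + \<delta> * w 1 else 0)"

lemma proj_transform_eq: "proj_transform \<alpha> \<beta> \<gamma> \<delta> P = linear_act \<alpha> \<beta> \<gamma> \<delta> ` P"
  unfolding proj_transform_def linear_act_def[abs_def] ..

lemma proj_transform_proj_point: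
  "proj_transform \<alpha> \<beta> \<gamma> \<delta> (proj_point w) = proj_point (linear_act \<alpha> \<beta> \<gamma> \<delta> w)"
proof -
  have "linear_act \<alpha> \<beta> \<gamma> \<delta> (cscale c w) = cscale c (linear_act \<alpha> \<beta> \<gamma> \<delta> w)" for c
    by (auto simp: linear_act_def cscale_def fun_eq_iff algebra_simps)
  then show ?thesis unfolding proj_transform_eq proj_point_def by (auto simp: image_iff) metis
qed

lemma proj_transform_comp:
  "proj_transform \<alpha> \<beta> \<gamma> \<delta> (proj_transform \<alpha>' \<beta>' \<gamma>' \<delta>' P) =
   proj_transform (\<alpha> * \<alpha>' + \<beta> * \<gamma>') (\<alpha> * \<beta>' + \<beta> * \<delta>') (\<gamma> * \<alpha>' + \<delta> * \<gamma>') (\<gamma> * \<beta>' + \<delta> * \<delta>') P"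
  unfolding proj_transform_eq image_image
  by (intro image_cong refl) (simp add: linear_act_def fun_eq_iff algebra_simps)

lemma proj_transform_scalar:
  assumes "e \<noteq> 0" "P \<in> P1"
  shows "proj_transform e 0 0 e P = P"
proof -
  obtain w where w: "w \<in> coord_space {0, 1}" "P = proj_point w"
    using assms(2) by (auto simp: proj_space_def)
  have "linear_act e 0 0 e w k = cscale e w k" for k
    using w(1) by (cases "k \<in> {0, 1}") (auto simp: linear_act_def cscale_def coord_space_def)
  then have "linear_act e 0 0 e w = cscale e w" ..
  then show ?thesis using assms(1) by (simp add: w(2) proj_transform_proj_point proj_point_cscale)
qed

lemma PGL2_comp:
  assumes "g \<in> PGL2" "h \<in> PGL2"
  shows "g \<circ> h \<in> PGL2"
proof -
  obtain \<alpha> \<beta> \<gamma> \<delta> where g: "g = proj_transform \<alpha> \<beta> \<gamma> \<delta>" "\<alpha> * \<delta> - \<beta> * \<gamma> \<noteq> 0"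
    using assms by (auto simp: PGL2_def)
  obtain \<alpha>' \<beta>' \<gamma>' \<delta>' where h: "h = proj_transform \<alpha>' \<beta>' \<gamma>' \<delta>'" "\<alpha>' * \<delta>' - \<beta>' * \<gamma>' \<noteq> 0"
    using assms by (auto simp: PGL2_def)
  have "(\<alpha> * \<alpha>' + \<beta> * \<gamma>') * (\<gamma> * \<beta>' + \<delta> * \<delta>') - (\<alpha> * \<beta>' + \<beta> * \<delta>') * (\<gamma> * \<alpha>' + \<delta> * \<gamma>') =
      (\<alpha> * \<delta> - \<beta> * \<gamma>) * (\<alpha>' * \<delta>' - \<beta>' * \<gamma>')"
    by (simp add: algebra_simps)
  also have "\<dots> \<noteq> 0" using g(2) h(2) by simp
  finally show ?thesis
    unfolding PGL2_def g(1) h(1) comp_def proj_transform_comp by blast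
qed

lemma PGL2_orbit_subset:
  assumes "g \<in> PGL2"
  shows "PGL2_orbit n (\<lambda>j\<in>{1..n}. g (a j)) \<subseteq> PGL2_orbit n a"
proof
  fix c assume "c \<in> PGL2_orbit n (\<lambda>j\<in>{1..n}. g (a j))"
  then obtain h where "h \<in> PGL2" "c = (\<lambda>j\<in>{1..n}. h ((\<lambda>j\<in>{1..n}. g (a j)) j))"
    by (auto simp: PGL2_orbit_def)
  then have "c = (\<lambda>j\<in>{1..n}. (h \<circ> g) (a j))" "h \<circ> g \<in> PGL2"
    using PGL2_comp assms by (auto simp: fun_eq_iff)
  then show "c \<in> PGL2_orbit n a" unfolding PGL2_orbit_def by blast
qed

lemma PGL2_orbit_self:
  assumes "a \<in> config_points n"
  shows "a \<in> PGL2_orbit n a"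
proof -
  have "a j = (\<lambda>j\<in>{1..n}. proj_transform 1 0 0 1 (a j)) j" for j
    using assms proj_transform_scalar[of 1 "a j"]
    by (cases "j \<in> {1..n}") (auto simp: config_points_def PiE_iff extensional_def)
  then have "a = (\<lambda>j\<in>{1..n}. proj_transform 1 0 0 1 (a j))" ..
  moreover have "proj_transform 1 0 0 1 \<in> PGL2"
    unfolding PGL2_def by (intro CollectI exI[of _ 0] exI[of _ 1]) simp
  ultimately show ?thesis unfolding PGL2_orbit_def by blast
qed

lemma PGL2_orbit_transform:
  assumes a: "a \<in> config_points n" and g: "\<alpha> * \<delta> - \<beta> * \<gamma> \<noteq> 0"
  shows "PGL2_orbit n (\<lambda>j\<in>{1..n}. proj_transform \<alpha> \<beta> \<gamma> \<delta> (a j)) = PGL2_orbit n a"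
proof
  let ?b = "\<lambda>j\<in>{1..n}. proj_transform \<alpha> \<beta> \<gamma> \<delta> (a j)"
  have "proj_transform \<alpha> \<beta> \<gamma> \<delta> \<in> PGL2" using g unfolding PGL2_def by blast
  then show "PGL2_orbit n ?b \<subseteq> PGL2_orbit n a" by (rule PGL2_orbit_subset)
  \<comment> \<open>The adjugate matrix represents the inverse transformation.\<close>
  have g': "\<delta> * \<alpha> - (- \<beta>) * (- \<gamma>) \<noteq> 0" using g by (simp add: mult.commute)
  then have inv: "proj_transform \<delta> (- \<beta>) (- \<gamma>) \<alpha> \<in> PGL2" unfolding PGL2_def by blast
  have "a j = (\<lambda>j\<in>{1..n}. proj_transform \<delta> (- \<beta>) (- \<gamma>) \<alpha> (?b j)) j" for j
  proof (cases "j \<in> {1..n}")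
    case True
    then have "a j \<in> P1" using a by (auto simp: config_points_def PiE_iff)
    from proj_transform_scalar[OF g this] True show ?thesis
      by (simp add: proj_transform_comp mult.commute)
  qed (use a in \<open>auto simp: config_points_def PiE_iff extensional_def\<close>)
  then have "a = (\<lambda>j\<in>{1..n}. proj_transform \<delta> (- \<beta>) (- \<gamma>) \<alpha> (?b j))" ..
  then show "PGL2_orbit n a \<subseteq> PGL2_orbit n ?b"
    using PGL2_orbit_subset[OF inv, of n ?b] by simp
qed

text \<open>A projective transformation multiplies all brackets by its determinant.\<close>

lemma config_transform:
  assumes a: "a \<in> config_points n" and g: "\<alpha> * \<delta> - \<beta> * \<gamma> \<noteq> 0" and n: "2 \<le> n"
  shows "(\<lambda>j\<in>{1..n}. proj_transform \<alpha> \<beta> \<gamma> \<delta> (a j)) \<in> config_points n"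
    "pt_of_config n (\<lambda>j\<in>{1..n}. proj_transform \<alpha> \<beta> \<gamma> \<delta> (a j)) = pt_of_config n a"
proof -
  let ?b = "\<lambda>j\<in>{1..n}. proj_transform \<alpha> \<beta> \<gamma> \<delta> (a j)"
  obtain x where x: "x \<in> config_coords n a" using config_coords_nonempty[OF a] by blast
  define y where "y = (\<lambda>(j, k). linear_act \<alpha> \<beta> \<gamma> \<delta> (\<lambda>k. x (j, k)) k)"
  have br: "bracket y i j = (\<alpha> * \<delta> - \<beta> * \<gamma>) * bracket x i j" for i j
    by (simp add: bracket_def y_def linear_act_def algebra_simps)
  have "?b = (\<lambda>j\<in>{1..n}. proj_point (\<lambda>k. y (j, k)))"
  proof (intro restrict_ext)
    fix j assume j: "j \<in> {1..n}"
    show "proj_transform \<alpha> \<beta> \<gamma> \<delta> (a j) = proj_point (\<lambda>k. y (j, k))"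
      unfolding config_pointsD(1)[OF a x j] proj_transform_proj_point by (simp add: y_def)
  qed
  moreover have "y \<in> coord_space ({1..n} \<times> {0, 1})"
    using x by (auto simp: config_coords_def coord_space_def y_def linear_act_def)
  moreover have "bracket y i j \<noteq> 0" if "i \<in> {1..n}" "j \<in> {1..n}" "i \<noteq> j" for i j
    unfolding br using bracket_nonzero[OF a x that] g by simp
  ultimately have b: "?b \<in> config_points n" "y \<in> config_coords n ?b"
    using config_pointsI[OF _ n] by blast+
  show "?b \<in> config_points n" by (rule b(1))
  show "pt_of_config n ?b = pt_of_config n a"
    unfolding pt_of_config_eq[OF n b] pt_of_config_eq[OF n a x]
    by (rule proj_point_parke_taylor_rescale[where e = "\<alpha> * \<delta> - \<beta> * \<gamma>" and c = "\<lambda>_. 1"])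
      (use g n br in auto)
qed

lemma pt_of_config_orbit:
  assumes "a \<in> config_points n" "a' \<in> config_points n" "PGL2_orbit n a = PGL2_orbit n a'" "2 \<le> n"
  shows "pt_of_config n a = pt_of_config n a'"
proof -
  have "a \<in> PGL2_orbit n a'" using PGL2_orbit_self[OF assms(1)] assms(3) by simp
  then obtain \<alpha> \<beta> \<gamma> \<delta> where "\<alpha> * \<delta> - \<beta> * \<gamma> \<noteq> 0"
    "a = (\<lambda>j\<in>{1..n}. proj_transform \<alpha> \<beta> \<gamma> \<delta> (a' j))"
    by (auto simp: PGL2_orbit_def PGL2_def)
  then show ?thesis using config_transform(2)[OF assms(2) _ assms(4)] by simp
qed

section \<open>The normal form of a configuration\<close>

text \<open>The normal form as a morphism on the open Parke--Taylor variety: applied to the Parke--Taylor point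
  of a configuration \<open>a\<close>, it returns the configuration in the orbit of \<open>a\<close> whose first three points
  are \<open>[1 : 0], [0 : 1], [1 : 1]\<close>.\<close>

lemma ex_normal_form_morphism:
  assumes n: "4 \<le> n"
  shows "\<exists>s. morphism (PT_open n) (config_space n) s \<and>
     (\<forall>a\<in>config_points n. \<exists>\<alpha> \<beta> \<gamma> \<delta>. \<alpha> * \<delta> - \<beta> * \<gamma> \<noteq> 0 \<and>
        s (pt_of_config n a) = (\<lambda>j\<in>{1..n}. proj_transform \<alpha> \<beta> \<gamma> \<delta> (a j)))"
proof -
  have n2: "2 \<le> n" using n by simp
  let ?hom = "mhom_fun (Sigma_perms n) (\<lambda>_. ())"
  define \<Phi> where "\<Phi> j d N M \<longleftrightarrow> ?hom d N \<and> ?hom d M \<and>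
     (\<forall>p. (\<forall>i k. p k i = - p i k) \<and> (\<forall>i\<in>{1..n}. \<forall>k\<in>{1..n}. i \<noteq> k \<longrightarrow> p i k \<noteq> 0) \<longrightarrow>
        (N (parke_taylor_vector n p) \<noteq> 0 \<or> M (parke_taylor_vector n p) \<noteq> 0) \<and>
        N (parke_taylor_vector n p) * (p 2 3 * p j 1) = M (parke_taylor_vector n p) * (p 2 j * p 3 1))"
    for j d N M
  have "\<exists>d N M. \<Phi> j d N M" if "j \<in> {1..n}" for j
    unfolding \<Phi>_def by (rule parke_taylor_normal_form[OF n that])
  then obtain d N M where \<Phi>: "\<And>j. j \<in> {1..n} \<Longrightarrow> \<Phi> j (d j) (N j) (M j)" by metis
  have hom: "?hom (d j) (N j)" "?hom (d j) (M j)" if "j \<in> {1..n}" for j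
    by (rule \<Phi>[OF that, unfolded \<Phi>_def, THEN conjunct1]
        \<Phi>[OF that, unfolded \<Phi>_def, THEN conjunct2, THEN conjunct1])+
  have val: "(N j (parke_taylor_vector n p) \<noteq> 0 \<or> M j (parke_taylor_vector n p) \<noteq> 0) \<and>
      N j (parke_taylor_vector n p) * (p 2 3 * p j 1) =
      M j (parke_taylor_vector n p) * (p 2 j * p 3 1)"
    if "j \<in> {1..n}" and p: "\<And>i k. p k i = - p i k"
      "\<And>i k. i \<in> {1..n} \<Longrightarrow> k \<in> {1..n} \<Longrightarrow> i \<noteq> k \<Longrightarrow> p i k \<noteq> 0" for j p
    by (rule \<Phi>[OF that(1), unfolded \<Phi>_def, THEN conjunct2, THEN conjunct2, THEN spec, THEN mp])
      (intro conjI allI ballI impI p)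
  define T where "T z = (\<lambda>(j, k). if j \<in> {1..n} then
      if k = (0::nat) then N j z else if k = 1 then M j z else 0 else 0)" for z
  define s where "s P = (\<lambda>j\<in>{1..n}. proj_point (\<lambda>k. T (SOME z. z \<in> P) (j, k)))" for P
  have key: "\<exists>\<alpha> \<beta> \<gamma> \<delta>. \<alpha> * \<delta> - \<beta> * \<gamma> \<noteq> 0 \<and> (\<forall>z\<in>pt_of_config n a. \<forall>j\<in>{1..n}.
      proj_point (\<lambda>k. T z (j, k)) = proj_transform \<alpha> \<beta> \<gamma> \<delta> (a j))"
    if a: "a \<in> config_points n" for a
  proof -
    obtain x where x: "x \<in> config_coords n a" using config_coords_nonempty[OF a] by blast
    let ?p = "bracket x"
    have nz: "?p i k \<noteq> 0" if "i \<in> {1..n}" "k \<in> {1..n}" "i \<noteq> k" for i k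
      using bracket_nonzero[OF a x that] .
    have nz': "?p 3 1 \<noteq> 0" "?p 2 3 \<noteq> 0" "?p 1 2 \<noteq> 0" "?p 2 1 \<noteq> 0" using nz n by auto
    \<comment> \<open>The matrix of \<open>v \<mapsto> (det (v2, v) * p 3 1, p 2 3 * det (v, v1))\<close>, which sends the column \<open>j\<close> to
      \<open>(p 2 j * p 3 1, p 2 3 * p j 1)\<close>.\<close>
    define \<alpha> \<beta> \<gamma> \<delta> where "\<alpha> = - ?p 3 1 * x (2, 1)" and "\<beta> = ?p 3 1 * x (2, 0)"
      and "\<gamma> = ?p 2 3 * x (1, 1)" and "\<delta> = - ?p 2 3 * x (1, 0)"
    have "\<alpha> * \<delta> - \<beta> * \<gamma> = ?p 3 1 * ?p 2 3 * ?p 1 2"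
      unfolding \<alpha>_def \<beta>_def \<gamma>_def \<delta>_def bracket_def[of x 1 2] by (simp add: algebra_simps)
    then have "\<alpha> * \<delta> - \<beta> * \<gamma> \<noteq> 0" using nz' by simp
    moreover have "proj_point (\<lambda>k. T z (j, k)) = proj_transform \<alpha> \<beta> \<gamma> \<delta> (a j)"
      if z: "z \<in> pt_of_config n a" and j: "j \<in> {1..n}" for z j
    proof -
      let ?z = "parke_taylor_vector n ?p"
      obtain c where c: "c \<noteq> 0" "z = cscale c ?z"
        using z unfolding pt_of_config_eq[OF n2 a x] mem_proj_point by blast
      define C where "C = (\<Prod>l\<in>(\<lambda>_. ()) ` Sigma_perms n. c ^ d j l)"
      have C: "C \<noteq> 0" unfolding C_def using c(1) finite_Sigma_perms by simp
      note hom = hom[OF j]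
      have sc: "N j z = C * N j ?z" "M j z = C * M j ?z"
        unfolding C_def
        by (rule mhom_fun_scale[OF finite_Sigma_perms hom(1)], simp add: c(2) cscale_def)
          (rule mhom_fun_scale[OF finite_Sigma_perms hom(2)], simp add: c(2) cscale_def)
      have NM: "N j ?z \<noteq> 0 \<or> M j ?z \<noteq> 0" "N j ?z * (?p 2 3 * ?p j 1) = M j ?z * (?p 2 j * ?p 3 1)"
        using val[where p = ?p, OF j bracket_skew nz] by blast+
      define w where "w = linear_act \<alpha> \<beta> \<gamma> \<delta> (\<lambda>k. x (j, k))"
      have w: "w 0 = ?p 2 j * ?p 3 1" "w 1 = ?p 2 3 * ?p j 1" "w \<in> coord_space {0, 1}"
        unfolding w_def linear_act_def \<alpha>_def \<beta>_def \<gamma>_def \<delta>_def bracket_def[of x 2 j] bracket_def[of x j 1]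
        by (auto simp: coord_space_def algebra_simps)
      have "proj_point (\<lambda>k. T z (j, k)) = proj_point w"
      proof (rule proj_point_P1_eqI[OF _ w(3)])
        show "(\<lambda>k. T z (j, k)) \<in> coord_space {0, 1}" by (auto simp: coord_space_def T_def)
        show "T z (j, 0) \<noteq> 0 \<or> T z (j, 1) \<noteq> 0" using NM(1) C j by (simp add: T_def sc)
        show "w 0 \<noteq> 0 \<or> w 1 \<noteq> 0"
        proof (cases "j = 2")
          case True
          then show ?thesis using nz' by (simp add: w del: One_nat_def)
        next
          case False
          then have "?p 2 j \<noteq> 0" using nz[of 2 j] n j by simp
          then show ?thesis using nz' by (simp add: w)
        qed
        show "T z (j, 0) * w 1 = T z (j, 1) * w 0"
          using NM(2) j by (simp add: T_def sc w del: One_nat_def)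
      qed
      then show ?thesis
        unfolding config_pointsD(1)[OF a x j] proj_transform_proj_point w_def .
    qed
    ultimately show ?thesis by blast
  qed
  have some: "(SOME z. z \<in> pt_of_config n a) \<in> pt_of_config n a" for a
    by (rule someI[of "\<lambda>z. z \<in> pt_of_config n a"]) (auto simp: pt_of_config_def intro: proj_point_self)
  have s: "\<exists>\<alpha> \<beta> \<gamma> \<delta>. \<alpha> * \<delta> - \<beta> * \<gamma> \<noteq> 0 \<and>
      s (pt_of_config n a) = (\<lambda>j\<in>{1..n}. proj_transform \<alpha> \<beta> \<gamma> \<delta> (a j)) \<and>
      (\<forall>z\<in>pt_of_config n a. \<forall>j\<in>{1..n}. proj_point (\<lambda>k. T z (j, k)) = s (pt_of_config n a) j)"
    if a: "a \<in> config_points n" for a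
  proof -
    obtain \<alpha> \<beta> \<gamma> \<delta> where g: "\<alpha> * \<delta> - \<beta> * \<gamma> \<noteq> 0"
      and k: "\<And>z j. z \<in> pt_of_config n a \<Longrightarrow> j \<in> {1..n} \<Longrightarrow>
        proj_point (\<lambda>k. T z (j, k)) = proj_transform \<alpha> \<beta> \<gamma> \<delta> (a j)"
      using key[OF a] by blast
    have "s (pt_of_config n a) = (\<lambda>j\<in>{1..n}. proj_transform \<alpha> \<beta> \<gamma> \<delta> (a j))"
      unfolding s_def by (intro restrict_ext k some)
    then show ?thesis using g k by (intro exI[of _ \<alpha>] exI[of _ \<beta>] exI[of _ \<gamma>] exI[of _ \<delta>]) simp
  qed
  have "morphism (PT_open n) (config_space n) s"
    unfolding config_space_eq PT_open_eq[OF n2]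
  proof (rule morphism_induced_variety[where T = T and D = d])
    show "finite ({1..n} \<times> {0, 1::nat})" by simp
    show "s P \<in> config_points n" if P: "P \<in> pt_of_config n ` config_points n" for P
    proof -
      obtain a where a: "a \<in> config_points n" "P = pt_of_config n a" using P by blast
      show ?thesis using s[OF a(1)] config_transform(1)[OF a(1) _ n2] a(2) by auto
    qed
    show "P \<noteq> {}" if "P \<in> pt_of_config n ` config_points n" for P
      using that some by blast
    show "?hom (d (fst i)) (\<lambda>z. T z i)" if I: "i \<in> {1..n} \<times> {0, 1}" for i
    proof -
      obtain j k where i: "i = (j, k)" "j \<in> {1..n}" "k \<in> {0, 1}" using I by blast
      then show ?thesis using hom[OF i(2)] by (auto simp: T_def)
    qed
    show "T z \<in> config_coords n (s P)" if P: "P \<in> pt_of_config n ` config_points n" and z: "z \<in> P" for P z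
    proof -
      obtain a where a: "a \<in> config_points n" "P = pt_of_config n a" using P by blast
      have "(\<lambda>k. T z (j, k)) \<in> s P j" if "j \<in> {1..n}" for j
        using s[OF a(1)] z that proj_point_self[of "\<lambda>k. T z (j, k)"] unfolding a(2) by metis
      moreover have "T z \<in> coord_space ({1..n} \<times> {0, 1})"
        by (auto simp: coord_space_def T_def)
      ultimately show ?thesis by (simp add: config_coords_def)
    qed
    show "\<exists>c. (\<forall>j. c j \<noteq> 0) \<and> (\<forall>i\<in>{1..n} \<times> {0, 1}. y i = c (fst i) * x i)"
      if "a \<in> config_points n" "x \<in> config_coords n a" "y \<in> config_coords n a" for a x y
      using config_coords_rescale[OF that] .
  qed
  then show ?thesis using s by blast
qed

section \<open>The isomorphism with the moduli space\<close>

theorem theorem3p1: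
  fixes n :: nat
  assumes "4 \<le> n"
  shows "isomorphic_varieties (PT_open n) (M0 n)"
proof -
  have n: "2 \<le> n" using assms by simp
  obtain s where s: "morphism (PT_open n) (config_space n) s"
    and norm: "\<And>a. a \<in> config_points n \<Longrightarrow> \<exists>\<alpha> \<beta> \<gamma> \<delta>. \<alpha> * \<delta> - \<beta> * \<gamma> \<noteq> 0 \<and>
        s (pt_of_config n a) = (\<lambda>j\<in>{1..n}. proj_transform \<alpha> \<beta> \<gamma> \<delta> (a j))"
    using ex_normal_form_morphism[OF assms] by blast
  have pc: "points (config_space n) = config_points n"
    unfolding config_space_eq by (rule points_induced_variety)
  have pp: "points (PT_open n) = pt_of_config n ` config_points n"
    unfolding PT_open_eq[OF n] by (rule points_induced_variety)
  show ?thesis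
    unfolding M0_def
  proof (rule isomorphic_quotient_fspace[OF config_space_eq pt_of_config_morphism[OF n] s];
      unfold pc pp)
    fix P assume "P \<in> pt_of_config n ` config_points n"
    then obtain a where a: "a \<in> config_points n" "P = pt_of_config n a" by blast
    then show "pt_of_config n (s P) = P"
      using norm[OF a(1)] config_transform(2)[OF a(1) _ n] by auto
  next
    fix a assume a: "a \<in> config_points n"
    then show "PGL2_orbit n (s (pt_of_config n a)) = PGL2_orbit n a"
      using norm[OF a] PGL2_orbit_transform[OF a] by auto
  next
    fix a a' assume "a \<in> config_points n" "a' \<in> config_points n" "PGL2_orbit n a = PGL2_orbit n a'"
    then show "pt_of_config n a = pt_of_config n a'" using n by (rule pt_of_config_orbit)
  qed
qed

end
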